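(* Consider an urn model with $K$ colors, with initial configuration $C_0$, replacement matrices $(R_n)_{n\ge1}$, drawn colors $(\chi_n)_{n\ge1}$, configurations $C_n$, total contents $S_n$ and count vectors $N_n$ as described in the context. Assume that $C_0$ is almost surely nonzero with almost surely nonnegative entries and finite mean; that $(R_n)_{n\ge1}$ is an i.i.d. sequence, independent of $C_0$, with irreducible mean matrix $H:=\mathbb E(R_1)$ and $\mathbb E(\rho(R_1))<\infty$; that for all $n\ge1$ and $i\in[K]$, $$\mathbb P\left(\chi_n=e_i\mid C_0,(R_m)_{m=1}^{n-1},(\chi_m)_{m=1}^{n-1}\right)=\frac{C_{n-1,i}}{S_{n-1}};$$ and that for every $n\ge1$ the family $(C_0,R_1,\dots,R_{n-1},\chi_1,\dots,\chi_n)$ is independent of $(R_m)_{m\ge n}$. Let $\lambda_H$ be the dominant eigenvalue of $H$ and $\pi_H$ the left eigenvector of $H$ for $\lambda_H$ with all coordinates strictly positive, normalized to be a probability vector. Then, as $n\to\infty$, both almost surely and in $L^1$, $$\frac{C_n}{S_n}\to\pi_H,\qquad \frac{S_n}{n}\to\lambda_H,\qquad \frac{C_n}{n}\to\lambda_H\pi_H,\qquad \frac{N_n}{n}\to\pi_H .$$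
   Context: Vectors are row vectors; $[K]=\{1,\dots,K\}$; $e_i$ is the $i$-th coordinate vector of $\mathbb R^K$. For a matrix $A$, $\rho(A):=\max_i\sum_j|A_{ij}|$. A square matrix $A$ with nonnegative entries is irreducible if for all $i,j\in[K]$ there is a positive integer $N$ (depending on $i,j$) such that the $(i,j)$ entry of $A^N$ is positive. The dominant eigenvalue of an irreducible matrix is its eigenvalue with largest real part; by Perron--Frobenius it is simple and positive with strictly positive left and right eigenvectors. Urn model: on a probability space, $C_0$ is a random vector in $\mathbb R^K$, $(R_n)_{n\ge1}$ are random $K\times K$ matrices with nonnegative entries (replacement matrices), and $(\chi_n)_{n\ge1}$ are random vectors with values in $\{e_1,\dots,e_K\}$ (the color drawn at trial $n$). The configuration vectors $C_n=(C_{n1},\dots,C_{nK})$ satisfy $C_n=C_{n-1}+\chi_nR_n$ for $n\ge1$; $S_n=\sum_{i=1}^KC_{ni}$; $N_n=\sum_{k=1}^n\chi_k$. *)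

theory Defs
  imports "HOL-Probability.Probability"
begin

text \<open>
  The colours are the elements of a finite type \<open>'k\<close>, so \<open>K = CARD('k)\<close>. Vectors are row vectors:
  the product of a row vector \<open>x\<close> with a matrix \<open>A\<close> is \<open>x v* A\<close>, and \<open>A $ i $ j\<close> is the entry in row
  \<open>i\<close> and column \<open>j\<close>.
\<close>

definition max_row_sum :: "real^'k^'k \<Rightarrow> real" where
  "max_row_sum A = Max (range (\<lambda>i. \<Sum>j\<in>UNIV. \<bar>A $ i $ j\<bar>))"

text \<open>The operations \<open>*\<close> and \<open>^\<close> on type \<open>vec\<close> act entrywise, hence a separate matrix power.\<close>

primrec matrix_power :: "real^'k^'k \<Rightarrow> nat \<Rightarrow> real^'k^'k" where
  "matrix_power A 0 = mat 1"
| "matrix_power A (Suc n) = matrix_power A n ** A"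

definition irreducible_matrix :: "real^'k^'k \<Rightarrow> bool" where
  "irreducible_matrix A \<longleftrightarrow>
     (\<forall>i j. 0 \<le> A $ i $ j) \<and> (\<forall>i j. \<exists>N>0. 0 < matrix_power A N $ i $ j)"

definition complex_eigenvalue :: "real^'k^'k \<Rightarrow> complex \<Rightarrow> bool" where
  "complex_eigenvalue A \<mu> \<longleftrightarrow>
     (\<exists>v::complex^'k. v \<noteq> 0 \<and> map_matrix complex_of_real A *v v = \<mu> *s v)"

text \<open>
  The eigenvalue with largest real part, among all complex eigenvalues. For an irreducible matrix it
  exists, is unique and is a positive real number (Perron--Frobenius), so it is given type \<open>real\<close>.
\<close>

definition dominant_eigenvalue :: "real^'k^'k \<Rightarrow> real" where
  "dominant_eigenvalue A =
     (THE l. complex_eigenvalue A (complex_of_real l) \<and>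
             (\<forall>\<mu>. complex_eigenvalue A \<mu> \<longrightarrow> Re \<mu> \<le> l))"

definition dominant_left_eigenvector :: "real^'k^'k \<Rightarrow> real^'k" where
  "dominant_left_eigenvector A =
     (THE p. p v* A = dominant_eigenvalue A *s p \<and> (\<forall>i. 0 < p $ i) \<and> (\<Sum>i\<in>UNIV. p $ i) = 1)"

text \<open>
  Independence of two random variables, as independence of the generated \<open>\<sigma>\<close>-algebras. In contrast
  to \<open>indep_var\<close> the two variables may take values in different types.
\<close>

definition indep_rvs ::
  "'a measure \<Rightarrow> 'b measure \<Rightarrow> ('a \<Rightarrow> 'b) \<Rightarrow> 'c measure \<Rightarrow> ('a \<Rightarrow> 'c) \<Rightarrow> bool" where
  "indep_rvs M S X T Y \<longleftrightarrow>
     prob_space.indep_set M (sets (vimage_algebra (space M) X S)) (sets (vimage_algebra (space M) Y T))"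

text \<open>
  \<open>C n\<close> is the configuration after \<open>n\<close> trials; \<open>R n\<close> and \<open>chi n\<close>, the replacement matrix and the
  colour drawn at trial \<open>n\<close>, are meaningful only for \<open>n \<ge> 1\<close>.
\<close>

locale urn_model = prob_space M for M :: "'a measure" +
  fixes C :: "nat \<Rightarrow> 'a \<Rightarrow> real^'k"
    and R :: "nat \<Rightarrow> 'a \<Rightarrow> real^'k^'k"
    and chi :: "nat \<Rightarrow> 'a \<Rightarrow> real^'k"
  assumes measurable_C0: "random_variable borel (C 0)"
    and measurable_R: "n \<ge> 1 \<Longrightarrow> random_variable borel (R n)"
    and measurable_chi: "n \<ge> 1 \<Longrightarrow> random_variable borel (chi n)"
    and R_nonneg: "n \<ge> 1 \<Longrightarrow> AE \<omega> in M. \<forall>i j. 0 \<le> R n \<omega> $ i $ j"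
    and chi_unit: "n \<ge> 1 \<Longrightarrow> AE \<omega> in M. \<exists>i. chi n \<omega> = axis i 1"
    and C_step: "n \<ge> 1 \<Longrightarrow> \<omega> \<in> space M \<Longrightarrow> C n \<omega> = C (n - 1) \<omega> + chi n \<omega> v* R n \<omega>"

definition total_content :: "(nat \<Rightarrow> 'a \<Rightarrow> real^'k) \<Rightarrow> nat \<Rightarrow> 'a \<Rightarrow> real" where
  "total_content C n \<omega> = (\<Sum>i\<in>UNIV. C n \<omega> $ i)"

definition count_vector :: "(nat \<Rightarrow> 'a \<Rightarrow> real^'k) \<Rightarrow> nat \<Rightarrow> 'a \<Rightarrow> real^'k" where
  "count_vector chi n \<omega> = (\<Sum>k=1..n. chi k \<omega>)"

text \<open>The family \<open>(C 0, R 1, \<dots>, R a, chi 1, \<dots>, chi b)\<close> as one random variable.\<close>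

definition urn_history ::
  "(nat \<Rightarrow> 'a \<Rightarrow> real^'k) \<Rightarrow> (nat \<Rightarrow> 'a \<Rightarrow> real^'k^'k) \<Rightarrow> (nat \<Rightarrow> 'a \<Rightarrow> real^'k) \<Rightarrow> nat \<Rightarrow> nat \<Rightarrow>
   'a \<Rightarrow> (real^'k) \<times> (nat \<Rightarrow> real^'k^'k) \<times> (nat \<Rightarrow> real^'k)" where
  "urn_history C R chi a b \<omega> = (C 0 \<omega>, (\<lambda>m\<in>{1..a}. R m \<omega>), (\<lambda>m\<in>{1..b}. chi m \<omega>))"

definition history_space ::
  "nat \<Rightarrow> nat \<Rightarrow> ((real^'k) \<times> (nat \<Rightarrow> real^'k^'k) \<times> (nat \<Rightarrow> real^'k)) measure" where
  "history_space a b =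
     borel \<Otimes>\<^sub>M PiM {1..a} (\<lambda>_. borel) \<Otimes>\<^sub>M PiM {1..b} (\<lambda>_. borel)"

definition converges_as_and_L1 ::
  "'a measure \<Rightarrow> (nat \<Rightarrow> 'a \<Rightarrow> 'b::{banach, second_countable_topology}) \<Rightarrow> 'b \<Rightarrow> bool" where
  "converges_as_and_L1 M X c \<longleftrightarrow>
     (AE \<omega> in M. (\<lambda>n. X n \<omega>) \<longlonglongrightarrow> c) \<and>
     (\<forall>n. integrable M (X n)) \<and> (\<lambda>n. \<integral>\<omega>. norm (X n \<omega> - c) \<partial>M) \<longlonglongrightarrow> 0"

end

theory Submission
  imports Defs "HOL-Library.Discrete_Functions"
begin

text \<open>
  Put \<open>p\<^sub>n = C\<^sub>n / S\<^sub>n\<close>. Adding and subtracting conditional means, the evolution of the urn reads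
  \<open>C\<^sub>n = \<xi>\<^sub>n + (p\<^sub>0 + \<dots> + p\<^bsub>n-1\<^esub>) H\<close>, where \<open>\<xi>\<^sub>n\<close> consists of \<open>C\<^sub>0\<close>, the replacement errors
  \<open>\<chi>\<^sub>k (R\<^sub>k - H)\<close> and the sampling errors \<open>(\<chi>\<^sub>k - p\<^bsub>k-1\<^esub>) H\<close>. The proof has a probabilistic half, which
  shows \<open>\<xi>\<^sub>n / n \<rightarrow> 0\<close> almost surely and in mean, and a deterministic half, which shows that every
  sequence with this recursion and a sublinear error satisfies \<open>p\<^sub>n \<rightarrow> \<pi>\<close>. Given both, Cesaro means yield
  \<open>C\<^sub>n / n \<rightarrow> \<pi> H = \<lambda> \<pi>\<close>, summing the coordinates yields the limit of \<open>S\<^sub>n / n\<close>, and the sampling errors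
  yield that of \<open>N\<^sub>n / n\<close>; everything except \<open>\<xi>\<^sub>n / n\<close> is bounded, so the convergence in mean comes from
  dominated convergence.

  The deterministic half avoids differential equations. Call a column vector \<open>w\<close> good if
  \<open>C\<^sub>n w \<ge> - \<epsilon> n\<close> eventually, for every \<open>\<epsilon> > 0\<close>. Since \<open>C\<^sub>n w\<close> grows by \<open>p\<^sub>n H w\<close> in each step, \<open>w\<close>
  is good as soon as \<open>w + H w\<close> is (\<open>asymptotically_nonneg_pullback\<close>), and every nonnegative
  vector is good. The matrix \<open>1 + H\<close> is primitive, so by Perron--Frobenius theory its powers bring
  any \<open>w\<close> with \<open>\<pi> w > 0\<close> into the nonnegative cone (\<open>irreducible_iterates_eventually_nonneg\<close>). Hence
  every such \<open>w\<close> is good, which forces \<open>p\<^sub>n w \<rightarrow> 0\<close> whenever \<open>\<pi> w = 0\<close>, that is, \<open>p\<^sub>n \<rightarrow> \<pi>\<close>. The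
  Perron--Frobenius facts themselves start from Brouwer's fixed point theorem on the simplex.

  In the probabilistic half the sampling errors are bounded and uncorrelated, so a second moment
  estimate along the squares suffices (\<open>strong_law_bounded_uncorrelated\<close>). The replacement errors have
  only a first moment. A constant truncation level splits each entry of \<open>R\<^sub>k\<close> into a bounded part,
  treated in the same way, and a nonnegative excess of small mean, for which a crude upper bound for
  the means of independent identically distributed variables is enough
  (\<open>strong_law_predictable_weights\<close>, \<open>nonneg_iid_mean_eventually_le\<close>).
\<close>

section \<open>Irreducible nonnegative matrices\<close>

lemma vec_mult_nth: "(x v* A) $ j = (\<Sum>i\<in>UNIV. x $ i * A $ i $ j)"
  by (simp add: vector_matrix_mult_def mult.commute)

lemma matrix_vec_mult_nth: "(A *v x) $ i = (\<Sum>j\<in>UNIV. A $ i $ j * x $ j)"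
  by (simp add: matrix_vector_mult_def)

lemma matrix_power_nonneg:
  fixes A :: "real^'k^'k"
  assumes "\<And>i j. 0 \<le> A $ i $ j"
  shows "0 \<le> matrix_power A n $ i $ j"
  by (induction n arbitrary: i j)
     (auto simp: mat_def matrix_matrix_mult_def intro!: sum_nonneg mult_nonneg_nonneg assms)

lemma matrix_power_Suc_left:
  fixes A :: "real^'k^'k"
  shows "matrix_power A (Suc n) = A ** matrix_power A n"
  by (induction n) (auto simp: matrix_mul_assoc[symmetric])

lemma matrix_power_transpose:
  fixes A :: "real^'k^'k"
  shows "matrix_power (transpose A) n = transpose (matrix_power A n)"
proof (induction n)
  case 0
  then show ?case by (simp add: transpose_mat)
next
  case (Suc n)
  have "matrix_power (transpose A) (Suc n) = transpose (matrix_power A n) ** transpose A"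
    by (simp add: Suc)
  also have "\<dots> = transpose (matrix_power A (Suc n))"
    by (simp only: matrix_power_Suc_left matrix_transpose_mul)
  finally show ?case .
qed

lemma irreducible_transpose:
  fixes A :: "real^'k^'k"
  assumes "irreducible_matrix A"
  shows "irreducible_matrix (transpose A)"
  using assms unfolding irreducible_matrix_def matrix_power_transpose
  by (auto simp: transpose_def)

lemma irreducible_nonneg:
  "irreducible_matrix A \<Longrightarrow> 0 \<le> A $ i $ j"
  by (simp add: irreducible_matrix_def)

lemma irreducible_power_pos:
  assumes "irreducible_matrix A"
  obtains N where "0 < matrix_power A N $ i $ j"
  using assms by (meson irreducible_matrix_def)

lemma irreducible_row_sum_pos:
  fixes A :: "real^'k^'k"
  assumes irr: "irreducible_matrix A"
  shows "0 < (\<Sum>j\<in>UNIV. A $ i $ j)"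
proof (rule ccontr)
  assume "\<not> ?thesis"
  then have "(\<Sum>j\<in>UNIV. A $ i $ j) = 0"
    using irreducible_nonneg[OF irr] by (meson linorder_not_le order_antisym sum_nonneg)
  then have row: "A $ i $ j = 0" for j
    using irreducible_nonneg[OF irr] by (subst (asm) sum_nonneg_eq_0_iff) auto
  have "matrix_power A (Suc n) $ i $ j = 0" for n j
  proof (induction n arbitrary: j)
    case 0
    show ?case by (simp add: row)
  next
    case (Suc n)
    have "matrix_power A (Suc (Suc n)) $ i $ j = (\<Sum>k\<in>UNIV. matrix_power A (Suc n) $ i $ k * A $ k $ j)"
      by (simp only: matrix_power.simps(2)[of A "Suc n"] matrix_matrix_mult_def vec_lambda_beta)
    then show ?case by (simp only: Suc) simp
  qed
  moreover obtain N where "N > 0" "0 < matrix_power A N $ i $ i"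
    using irr unfolding irreducible_matrix_def by blast
  ultimately show False
    by (metis Suc_pred less_irrefl)
qed

lemma left_eigenvector_power:
  fixes A :: "real^'k^'k"
  assumes "x v* A = l *\<^sub>R x"
  shows "x v* matrix_power A n = l ^ n *\<^sub>R x"
  by (induction n) (simp_all add: vector_matrix_mul_assoc[symmetric] assms scaleR_vector_matrix_assoc mult.commute)

text \<open>
  Mass at one index is transported to every other index by a suitable power of the matrix, and for
  an eigenvector that power acts as a scalar.
\<close>

lemma nonneg_left_eigenvector_pos:
  fixes A :: "real^'k^'k"
  assumes irr: "irreducible_matrix A" and ev: "x v* A = l *\<^sub>R x" and l: "l > 0"
    and nn: "\<And>i. 0 \<le> x $ i" and "x \<noteq> 0"
  shows "0 < x $ j"
proof -
  obtain i where i: "x $ i > 0"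
    using nn \<open>x \<noteq> 0\<close> by (metis order_less_le vec_eq_iff zero_index)
  obtain N where N: "0 < matrix_power A N $ i $ j"
    by (rule irreducible_power_pos[OF irr])
  have "0 < x $ i * matrix_power A N $ i $ j"
    using i N by simp
  also have "\<dots> \<le> (\<Sum>i\<in>UNIV. x $ i * matrix_power A N $ i $ j)"
    by (rule member_le_sum)
       (auto intro!: mult_nonneg_nonneg nn matrix_power_nonneg irreducible_nonneg[OF irr])
  also have "\<dots> = l ^ N * x $ j"
    using arg_cong[OF left_eigenvector_power[OF ev, of N], of "\<lambda>v. v $ j"]
    by (simp add: vec_mult_nth)
  finally show ?thesis
    using l by (simp add: zero_less_mult_iff)
qed

text \<open>
  The left action followed by normalisation is a continuous self-map of the simplex of probability
  vectors; its fixed points are exactly the normalised nonnegative eigenvectors, and Brouwer's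
  theorem supplies one.
\<close>

lemma positive_left_eigenvector_exists:
  fixes A :: "real^'k^'k"
  assumes irr: "irreducible_matrix A"
  obtains p l where "l > 0" "p v* A = l *\<^sub>R p" "\<And>i. 0 < p $ i" "(\<Sum>i\<in>UNIV. p $ i) = 1"
proof -
  define D where "D = {x::real^'k. (\<forall>i. 0 \<le> x $ i) \<and> (\<Sum>i\<in>UNIV. x $ i) = 1}"
  define g where "g x = (\<Sum>j\<in>UNIV. (x v* A) $ j)" for x
  note nnA = irreducible_nonneg[OF irr]
  have g_eq: "g x = (\<Sum>i\<in>UNIV. x $ i * (\<Sum>j\<in>UNIV. A $ i $ j))" for x
    unfolding g_def vec_mult_nth by (subst sum.swap) (simp add: sum_distrib_left)
  have D_ne0: "x \<noteq> 0" if "x \<in> D" for x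
    using that by (auto simp: D_def)
  have g_pos: "g x > 0" if xD: "x \<in> D" for x
  proof -
    have nn: "0 \<le> x $ i" for i
      using xD by (simp add: D_def)
    obtain i where i: "x $ i > 0"
      using D_ne0[OF xD] nn by (metis order_less_le vec_eq_iff zero_index)
    then have "0 < x $ i * (\<Sum>j\<in>UNIV. A $ i $ j)"
      using irreducible_row_sum_pos[OF irr] i by simp
    also have "\<dots> \<le> g x"
      unfolding g_eq by (rule member_le_sum) (auto intro!: mult_nonneg_nonneg nn sum_nonneg nnA)
    finally show ?thesis .
  qed
  define f where "f x = (x v* A) /\<^sub>R g x" for x
  have le1: "x $ i \<le> 1" if "x \<in> D" for x i
  proof -
    have "x $ i \<le> (\<Sum>i\<in>UNIV. x $ i)"
      using that by (intro member_le_sum) (auto simp: D_def)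
    then show ?thesis
      using that by (simp add: D_def)
  qed
  have "bounded D"
  proof (rule boundedI)
    fix x assume x: "x \<in> D"
    have "norm x \<le> (\<Sum>i\<in>UNIV. \<bar>x $ i\<bar>)"
      by (rule norm_le_l1_cart)
    also have "\<dots> = 1"
      using x by (simp add: D_def)
    finally show "norm x \<le> 1" .
  qed
  moreover have "closed D"
  proof -
    have "closed {x::real^'k. 0 \<le> x $ i}" for i
      by (intro closed_Collect_le continuous_intros)
    moreover have "closed {x::real^'k. (\<Sum>i\<in>UNIV. x $ i) = 1}"
      by (intro closed_Collect_eq continuous_intros)
    moreover have "D = (\<Inter>i. {x. 0 \<le> x $ i}) \<inter> {x. (\<Sum>i\<in>UNIV. x $ i) = 1}"
      by (auto simp: D_def)
    ultimately show ?thesis by auto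
  qed
  ultimately have comp: "compact D"
    by (simp add: compact_eq_bounded_closed)
  have conv: "convex D"
    by (rule convexI)
       (auto simp: D_def sum.distrib sum_distrib_left[symmetric])
  have "axis undefined 1 \<in> D"
    by (auto simp: D_def axis_def)
  then have ne: "D \<noteq> {}" by auto
  have contA: "continuous_on D (\<lambda>x. x v* A)"
    unfolding transpose_matrix_vector[symmetric]
    by (rule matrix_vector_mult_linear_continuous_on)
  have contg: "continuous_on D g"
    unfolding g_eq by (intro continuous_intros)
  have "continuous_on D f"
    unfolding f_def using g_pos by (intro continuous_intros contA contg) force
  moreover have "f \<in> D \<rightarrow> D"
  proof
    fix x assume x: "x \<in> D"
    have "0 \<le> (x v* A) $ j" for j
      unfolding vec_mult_nth using x by (auto simp: D_def intro!: sum_nonneg mult_nonneg_nonneg nnA)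
    moreover have "(\<Sum>j\<in>UNIV. f x $ j) = 1"
      using g_pos[OF x] by (simp add: f_def g_def sum_distrib_left[symmetric])
    ultimately show "f x \<in> D"
      using g_pos[OF x] by (auto simp: D_def f_def)
  qed
  ultimately obtain p where p: "p \<in> D" "f p = p"
    using brouwer[OF comp conv ne] by blast
  have ev: "p v* A = g p *\<^sub>R p"
    using g_pos[OF p(1)] p(2) by (metis f_def less_irrefl right_inverse scaleR_one scaleR_scaleR)
  show ?thesis
  proof
    show "g p > 0" by (rule g_pos[OF p(1)])
    show "p v* A = g p *\<^sub>R p" by (rule ev)
    show "0 < p $ i" for i
      by (rule nonneg_left_eigenvector_pos[OF irr ev g_pos[OF p(1)]])
         (use p(1) D_ne0[OF p(1)] in \<open>auto simp: D_def\<close>)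
    show "(\<Sum>i\<in>UNIV. p $ i) = 1"
      using p(1) by (simp add: D_def)
  qed
qed

lemma inner_pos_pos:
  fixes x y :: "real^'k"
  assumes "\<And>i. 0 < x $ i" "\<And>i. 0 < y $ i"
  shows "0 < x \<bullet> y"
  unfolding inner_vec_def using assms by (auto intro!: sum_pos)

text \<open>
  A multiple \<open>t\<close> of \<open>q\<close> is subtracted from \<open>p\<close> until a coordinate vanishes; what remains is a
  nonnegative eigenvector with a zero coordinate, hence zero.
\<close>

lemma positive_left_eigenvector_unique:
  fixes A :: "real^'k^'k"
  assumes irr: "irreducible_matrix A" and l: "l > 0"
    and p: "p v* A = l *\<^sub>R p" "\<And>i. 0 < p $ i" "(\<Sum>i\<in>UNIV. p $ i) = 1"
    and q: "q v* A = l *\<^sub>R q" "\<And>i. 0 < q $ i" "(\<Sum>i\<in>UNIV. q $ i) = 1"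
  shows "p = q"
proof -
  define t where "t = Min (range (\<lambda>i. p $ i / q $ i))"
  have "t \<in> range (\<lambda>i. p $ i / q $ i)"
    unfolding t_def by (rule Min_in) auto
  then obtain i where i: "t = p $ i / q $ i" by auto
  have tle: "t \<le> p $ j / q $ j" for j
    unfolding t_def by (rule Min_le) auto
  have ev: "(p - t *\<^sub>R q) v* A = l *\<^sub>R (p - t *\<^sub>R q)"
    by (simp add: scaleR_vector_matrix_assoc p q scaleR_diff_right algebra_simps)
  have nn: "0 \<le> (p - t *\<^sub>R q) $ j" for j
    using tle[of j] q(2)[of j] by (simp add: field_simps)
  have "(p - t *\<^sub>R q) $ i = 0"
    using q(2)[of i] by (simp add: i)
  then have "p - t *\<^sub>R q = 0"
    using nonneg_left_eigenvector_pos[OF irr ev l nn, of i] by auto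
  then have pt: "p = t *\<^sub>R q" by simp
  have "1 = t * (\<Sum>i\<in>UNIV. q $ i)"
    using p(3) unfolding pt by (simp add: sum_distrib_left)
  then show ?thesis using pt q(3) by simp
qed

text \<open>
  Pairing the moduli of the entries of a complex eigenvector with a positive left eigenvector shows
  that no eigenvalue exceeds the Perron root in modulus.
\<close>

lemma complex_eigenvalue_norm_le:
  fixes A :: "real^'k^'k"
  assumes nnA: "\<And>i j. 0 \<le> A $ i $ j"
    and p: "p v* A = l *\<^sub>R p" "\<And>i. 0 < p $ i"
    and mu: "complex_eigenvalue A \<mu>"
  shows "cmod \<mu> \<le> l"
proof -
  obtain v :: "complex^'k" where v: "v \<noteq> 0" "map_matrix complex_of_real A *v v = \<mu> *s v"
    using mu by (auto simp: complex_eigenvalue_def)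
  define w :: "real^'k" where "w = (\<chi> i. cmod (v $ i))"
  have "cmod \<mu> * w $ i \<le> (A *v w) $ i" for i
  proof -
    have "cmod \<mu> * w $ i = cmod ((map_matrix complex_of_real A *v v) $ i)"
      by (simp add: v(2) w_def norm_mult)
    also have "\<dots> = cmod (\<Sum>j\<in>UNIV. of_real (A $ i $ j) * v $ j)"
      by (simp add: matrix_vec_mult_nth matrix_vector_mult_def map_matrix_def)
    also have "\<dots> \<le> (\<Sum>j\<in>UNIV. cmod (of_real (A $ i $ j) * v $ j))"
      by (rule norm_sum)
    also have "\<dots> = (A *v w) $ i"
      using nnA by (simp add: matrix_vec_mult_nth w_def norm_mult)
    finally show ?thesis .
  qed
  then have "(\<Sum>i\<in>UNIV. p $ i * (cmod \<mu> * w $ i)) \<le> (\<Sum>i\<in>UNIV. p $ i * (A *v w) $ i)"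
    using p(2) by (intro sum_mono mult_left_mono) (auto intro: less_imp_le)
  then have "cmod \<mu> * (p \<bullet> w) \<le> p \<bullet> (A *v w)"
    by (simp add: inner_vec_def sum_distrib_left mult_ac)
  also have "\<dots> = l * (p \<bullet> w)"
    by (simp add: dot_lmul_matrix[symmetric] p(1))
  finally have "cmod \<mu> * (p \<bullet> w) \<le> l * (p \<bullet> w)" .
  moreover have "p \<bullet> w > 0"
  proof -
    obtain i where "v $ i \<noteq> 0" using v(1) by (auto simp: vec_eq_iff)
    then have "0 < p $ i * w $ i" using p(2) by (simp add: w_def)
    also have "\<dots> \<le> (\<Sum>i\<in>UNIV. p $ i * w $ i)"
      using p(2) by (intro member_le_sum) (auto simp: w_def less_imp_le)
    finally show ?thesis by (simp add: inner_vec_def)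
  qed
  ultimately show ?thesis by simp
qed

text \<open>
  The left and right Perron roots agree because both eigenvectors are positive, so that their product
  does not vanish.
\<close>

theorem perron_frobenius:
  fixes A :: "real^'k^'k"
  assumes irr: "irreducible_matrix A"
  defines "l \<equiv> dominant_eigenvalue A" and "p \<equiv> dominant_left_eigenvector A"
  shows dominant_eigenvalue_pos: "l > 0"
    and dominant_left_eigenvector_eq: "p v* A = l *\<^sub>R p"
    and dominant_left_eigenvector_pos: "0 < p $ i"
    and dominant_left_eigenvector_sum: "(\<Sum>i\<in>UNIV. p $ i) = 1"
    and positive_right_eigenvector_exists: "\<exists>u. A *v u = l *\<^sub>R u \<and> (\<forall>i. 0 < u $ i)"
proof -
  obtain q m where q: "m > 0" "q v* A = m *\<^sub>R q" "\<And>i. 0 < q $ i" "(\<Sum>i\<in>UNIV. q $ i) = 1"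
    by (rule positive_left_eigenvector_exists[OF irr]) blast
  obtain u m' where u: "A *v u = m' *\<^sub>R u" "\<And>i. 0 < u $ i"
    by (rule positive_left_eigenvector_exists[OF irreducible_transpose[OF irr]]) auto
  have "m * (q \<bullet> u) = m' * (q \<bullet> u)"
    using dot_lmul_matrix[of q A u] by (simp add: q(2) u(1))
  then have m': "m' = m"
    using inner_pos_pos[of q u] q(3) u(2) by auto
  have "complex_eigenvalue A (complex_of_real m)"
    unfolding complex_eigenvalue_def
  proof (intro exI conjI)
    show "(\<chi> i. complex_of_real (u $ i)) \<noteq> 0"
      using u(2) by (auto simp: vec_eq_iff) (metis less_irrefl)
    have "(\<Sum>j\<in>UNIV. A $ i $ j * u $ j) = m * u $ i" for i
      using arg_cong[OF u(1), of "\<lambda>v. v $ i"] by (simp add: matrix_vec_mult_nth m')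
    then show "map_matrix complex_of_real A *v (\<chi> i. complex_of_real (u $ i))
          = complex_of_real m *s (\<chi> i. complex_of_real (u $ i))"
      by (simp add: vec_eq_iff matrix_vector_mult_def map_matrix_def flip: of_real_mult of_real_sum)
  qed
  moreover have "Re \<mu> \<le> m" if "complex_eigenvalue A \<mu>" for \<mu>
    using complex_eigenvalue_norm_le[OF irreducible_nonneg[OF irr] q(2,3) that]
      complex_Re_le_cmod[of \<mu>] by linarith
  ultimately have l: "l = m"
    unfolding l_def dominant_eigenvalue_def
    by (intro the_equality) (auto intro!: antisym, metis Re_complex_of_real)
  have "p = q"
    unfolding p_def dominant_left_eigenvector_def l[unfolded l_def] scalar_mult_eq_scaleR
    by (rule the_equality) (use q positive_left_eigenvector_unique[OF irr q(1)] in auto)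
  then show "l > 0" "p v* A = l *\<^sub>R p" "0 < p $ i" "(\<Sum>i\<in>UNIV. p $ i) = 1"
    using q l by auto
  show "\<exists>u. A *v u = l *\<^sub>R u \<and> (\<forall>i. 0 < u $ i)"
    using u m' l by auto
qed

subsection \<open>Iterates of a primitive matrix\<close>

text \<open>
  Adding the identity removes periodicity: paths of every length up to \<open>n\<close> contribute to
  the \<open>n\<close>-th power. This makes a single exponent possible for which all entries are positive.
\<close>

lemma matrix_power_shifted_ge:
  fixes A :: "real^'k^'k"
  assumes nnA: "\<And>i j. 0 \<le> A $ i $ j" and "m \<le> n"
  shows "matrix_power A m $ i $ j \<le> matrix_power (mat 1 + A) n $ i $ j"
  using \<open>m \<le> n\<close>
proof (induction n arbitrary: m j)
  case 0
  then show ?case by simp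
next
  case (Suc n)
  have nnB: "0 \<le> matrix_power (mat 1 + A) n $ i $ j" for i j
    by (rule matrix_power_nonneg) (simp add: mat_def nnA)
  have step: "matrix_power (mat 1 + A) (Suc n) $ i $ j = matrix_power (mat 1 + A) n $ i $ j
      + (\<Sum>k\<in>UNIV. matrix_power (mat 1 + A) n $ i $ k * A $ k $ j)"
    by (simp add: matrix_add_ldistrib) (simp add: matrix_matrix_mult_def)
  show ?case
  proof (cases "m \<le> n")
    case True
    then show ?thesis
      unfolding step using Suc.IH[of m j]
      by (meson add_increasing2 mult_nonneg_nonneg nnA nnB sum_nonneg)
  next
    case False
    then have m: "m = Suc n" using Suc.prems by simp
    have "matrix_power A m $ i $ j = (\<Sum>k\<in>UNIV. matrix_power A n $ i $ k * A $ k $ j)"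
      by (simp add: m matrix_matrix_mult_def)
    also have "\<dots> \<le> (\<Sum>k\<in>UNIV. matrix_power (mat 1 + A) n $ i $ k * A $ k $ j)"
      by (intro sum_mono mult_right_mono Suc.IH nnA) simp
    finally show ?thesis
      unfolding step using nnB[of i j] by linarith
  qed
qed

lemma irreducible_shifted_power_pos:
  fixes A :: "real^'k^'k"
  assumes irr: "irreducible_matrix A"
  obtains n where "\<And>i j. 0 < matrix_power (mat 1 + A) n $ i $ j"
proof -
  have "\<forall>z. \<exists>m. 0 < matrix_power A m $ fst z $ snd z"
    using irreducible_power_pos[OF irr] by metis
  then obtain m where m: "\<And>z. 0 < matrix_power A (m z) $ fst z $ snd z"
    by metis
  define n where "n = Max (range m)"
  have "0 < matrix_power (mat 1 + A) n $ i $ j" for i j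
  proof -
    have "m (i, j) \<le> n" unfolding n_def by (rule Max_ge) auto
    from matrix_power_shifted_ge[OF irreducible_nonneg[OF irr] this, of i j] m[of "(i, j)"]
    show ?thesis by simp
  qed
  then show ?thesis by (rule that)
qed

lemma matrix_power_vec_mult:
  fixes A :: "real^'k^'k"
  shows "(*v) (matrix_power A n) = ((*v) A) ^^ n"
proof (induction n)
  case (Suc n)
  show ?case
    by (rule ext)
       (simp only: matrix_power_Suc_left matrix_vector_mul_assoc[symmetric] Suc funpow.simps comp_def)
qed auto

lemma funpow_matrix_eigenvector:
  fixes G :: "real^'k^'k"
  assumes "G *v u = c *\<^sub>R u"
  shows "((*v) G ^^ m) u = c ^ m *\<^sub>R u"
  by (induction m) (simp_all add: assms matrix_vector_mult_scaleR mult.commute)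

lemma funpow_matrix_linear:
  fixes G :: "real^'k^'k"
  shows "((*v) G ^^ m) (x + t *\<^sub>R y) = ((*v) G ^^ m) x + t *\<^sub>R ((*v) G ^^ m) y"
  by (induction m) (simp_all add: matrix_vector_right_distrib matrix_vector_mult_scaleR)

text \<open>
  A positive matrix dominates a multiple of the rank-one projection onto its Perron
  eigenvector. On the kernel of that projection only the nonnegative remainder acts, whose
  Perron root is strictly smaller, so the component along \<open>u\<close> wins.
\<close>

lemma positive_matrix_iterates_eventually_nonneg:
  fixes G :: "real^'k^'k"
  assumes G: "\<And>i j. 0 < G $ i $ j"
    and p: "p v* G = \<kappa> *\<^sub>R p" "\<And>i. 0 < p $ i"
    and u: "G *v u = \<kappa> *\<^sub>R u" "\<And>i. 0 < u $ i"
    and w: "0 < p \<bullet> w"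
  shows "\<exists>m. \<forall>i. 0 \<le> ((*v) G ^^ m) w $ i"
proof -
  have pu: "p \<bullet> u > 0" by (rule inner_pos_pos[OF p(2) u(2)])
  \<comment> \<open>The largest multiple of the matrix \<open>u $ i * p $ j\<close> that lies below \<open>G\<close>.\<close>
  define \<delta> where "\<delta> = Min (range (\<lambda>z. G $ fst z $ snd z / (u $ fst z * p $ snd z)))"
  have "\<delta> \<in> range (\<lambda>z. G $ fst z $ snd z / (u $ fst z * p $ snd z))"
    unfolding \<delta>_def by (rule Min_in) auto
  then have \<delta>: "\<delta> > 0" using G p(2) u(2) by auto
  have B: "0 \<le> G $ i $ j - \<delta> * u $ i * p $ j" for i j
  proof -
    have "\<delta> \<le> G $ i $ j / (u $ i * p $ j)"
      unfolding \<delta>_def by (rule Min_le) (auto intro!: image_eqI[of _ _ "(i, j)"])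
    then show ?thesis using p(2)[of j] u(2)[of i] by (simp add: field_simps)
  qed
  define \<kappa>' where "\<kappa>' = \<kappa> - \<delta> * (p \<bullet> u)"
  have Bz: "(G *v z) $ i = (\<Sum>j\<in>UNIV. (G $ i $ j - \<delta> * u $ i * p $ j) * z $ j) + \<delta> * u $ i * (p \<bullet> z)" for z i
    by (simp add: matrix_vec_mult_nth left_diff_distrib sum_subtractf inner_vec_def sum_distrib_left mult.assoc)
  have Bu: "(\<Sum>j\<in>UNIV. (G $ i $ j - \<delta> * u $ i * p $ j) * u $ j) = \<kappa>' * u $ i" for i
    using Bz[of u i] by (simp add: u(1) \<kappa>'_def algebra_simps)
  have \<kappa>'0: "\<kappa>' \<ge> 0"
  proof -
    have "0 \<le> \<kappa>' * u $ undefined"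
      unfolding Bu[symmetric] by (intro sum_nonneg mult_nonneg_nonneg B less_imp_le[OF u(2)])
    then show ?thesis using u(2)[of undefined] by (simp add: zero_le_mult_iff)
  qed
  have \<kappa>'\<kappa>: "\<kappa>' < \<kappa>" using \<delta> pu by (simp add: \<kappa>'_def)
  \<comment> \<open>Split \<open>w\<close> into its component along \<open>u\<close> and a remainder annihilated by \<open>p\<close>.\<close>
  define t where "t = (p \<bullet> w) / (p \<bullet> u)"
  have t: "t > 0" using w pu by (simp add: t_def)
  define z where "z = w - t *\<^sub>R u"
  have pz: "p \<bullet> z = 0" using pu by (simp add: z_def t_def inner_diff_right)
  define c where "c = Max (range (\<lambda>i. \<bar>z $ i\<bar> / u $ i))"
  have c: "\<bar>z $ i\<bar> \<le> c * u $ i" for i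
  proof -
    have "\<bar>z $ i\<bar> / u $ i \<le> c" unfolding c_def by (rule Max_ge) auto
    then show ?thesis using u(2)[of i] by (simp add: field_simps)
  qed
  have c0: "c \<ge> 0"
    using c[of undefined] u(2)[of undefined] by (smt (verit) zero_le_mult_iff)
  have bound: "p \<bullet> ((*v) G ^^ m) z = 0 \<and> (\<forall>i. \<bar>((*v) G ^^ m) z $ i\<bar> \<le> c * \<kappa>' ^ m * u $ i)" for m
  proof (induction m)
    case 0
    then show ?case using pz c by simp
  next
    case (Suc m)
    let ?z = "((*v) G ^^ m) z"
    have "\<bar>(G *v ?z) $ i\<bar> \<le> c * \<kappa>' ^ Suc m * u $ i" for i
    proof -
      have "\<bar>(G *v ?z) $ i\<bar> = \<bar>\<Sum>j\<in>UNIV. (G $ i $ j - \<delta> * u $ i * p $ j) * ?z $ j\<bar>"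
        using Suc by (simp add: Bz)
      also have "\<dots> \<le> (\<Sum>j\<in>UNIV. (G $ i $ j - \<delta> * u $ i * p $ j) * (c * \<kappa>' ^ m * u $ j))"
        by (rule order_trans[OF sum_abs sum_mono])
           (use Suc B in \<open>auto simp: abs_mult abs_of_nonneg intro!: mult_left_mono\<close>)
      also have "\<dots> = c * \<kappa>' ^ m * (\<Sum>j\<in>UNIV. (G $ i $ j - \<delta> * u $ i * p $ j) * u $ j)"
        by (simp add: sum_distrib_left mult_ac)
      also have "\<dots> = c * \<kappa>' ^ Suc m * u $ i"
        by (simp add: Bu)
      finally show ?thesis .
    qed
    then show ?case using Suc by (simp add: dot_lmul_matrix[symmetric] p(1))
  qed
  have "\<kappa> > 0" using \<kappa>'0 \<kappa>'\<kappa> by simp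
  obtain m where m: "(\<kappa>' / \<kappa>) ^ m < t / (c + 1)"
    using real_arch_pow_inv[of "t / (c + 1)" "\<kappa>' / \<kappa>"] t c0 \<kappa>'0 \<kappa>'\<kappa> by auto
  have "c * \<kappa>' ^ m \<le> (c + 1) * \<kappa>' ^ m"
    using \<kappa>'0 by (intro mult_right_mono) auto
  also have "\<dots> \<le> t * \<kappa> ^ m"
    using m c0 \<open>\<kappa> > 0\<close> by (simp add: power_divide field_simps)
  finally have le: "c * \<kappa>' ^ m \<le> t * \<kappa> ^ m" .
  have "0 \<le> ((*v) G ^^ m) w $ i" for i
  proof -
    have "w = z + t *\<^sub>R u" by (simp add: z_def)
    then have "((*v) G ^^ m) w $ i = ((*v) G ^^ m) z $ i + t * \<kappa> ^ m * u $ i"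
      by (simp add: funpow_matrix_linear funpow_matrix_eigenvector[OF u(1)])
    moreover have "- (c * \<kappa>' ^ m * u $ i) \<le> ((*v) G ^^ m) z $ i"
      using bound[of m] by (metis abs_le_D2 minus_le_iff)
    moreover have "c * \<kappa>' ^ m * u $ i \<le> t * \<kappa> ^ m * u $ i"
      using le u(2)[of i] by (intro mult_right_mono) auto
    ultimately show ?thesis by linarith
  qed
  then show ?thesis by auto
qed

lemma irreducible_iterates_eventually_nonneg:
  fixes A :: "real^'k^'k"
  assumes irr: "irreducible_matrix A"
    and p: "p v* A = l *\<^sub>R p" "\<And>i. 0 < p $ i"
    and u: "A *v u = l *\<^sub>R u" "\<And>i. 0 < u $ i"
    and w: "0 < p \<bullet> w"
  shows "\<exists>m. \<forall>i. 0 \<le> ((\<lambda>v. v + A *v v) ^^ m) w $ i"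
proof -
  obtain n where n: "\<And>i j. 0 < matrix_power (mat 1 + A) n $ i $ j"
    using irreducible_shifted_power_pos[OF irr] by blast
  have shift: "(*v) (mat 1 + A) = (\<lambda>v. v + A *v v)"
    by (simp add: matrix_vector_mult_add_rdistrib fun_eq_iff)
  have "p v* (mat 1 + A) = (1 + l) *\<^sub>R p"
    by (simp add: vector_matrix_mult_add_rdistrib p(1) scaleR_left_distrib)
  then have "p v* matrix_power (mat 1 + A) n = (1 + l) ^ n *\<^sub>R p"
    by (rule left_eigenvector_power)
  moreover have "(mat 1 + A) *v u = (1 + l) *\<^sub>R u"
    by (simp add: matrix_vector_mult_add_rdistrib u(1) scaleR_left_distrib)
  then have "matrix_power (mat 1 + A) n *v u = (1 + l) ^ n *\<^sub>R u"
    using funpow_matrix_eigenvector by (simp add: matrix_power_vec_mult)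
  ultimately obtain m where "\<forall>i. 0 \<le> ((*v) (matrix_power (mat 1 + A) n) ^^ m) w $ i"
    using positive_matrix_iterates_eventually_nonneg[OF n _ p(2) _ u(2) w] by blast
  then show ?thesis
    by (auto simp: matrix_power_vec_mult shift funpow_mult)
qed

section \<open>Sequences driven by an irreducible matrix up to a sublinear error\<close>

lemma sublinear_inner:
  fixes x :: "nat \<Rightarrow> 'b::euclidean_space"
  assumes lim: "(\<lambda>n. x n /\<^sub>R real n) \<longlonglongrightarrow> 0" and e: "e > 0"
  shows "eventually (\<lambda>n. \<bar>x n \<bullet> w\<bar> \<le> e * real n) sequentially"
proof -
  have "(\<lambda>n. (x n /\<^sub>R real n) \<bullet> w) \<longlonglongrightarrow> 0 \<bullet> w"
    by (intro tendsto_intros lim)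
  then have "eventually (\<lambda>n. dist ((x n /\<^sub>R real n) \<bullet> w) 0 < e) sequentially"
    using e by (intro tendstoD) auto
  then show ?thesis
    using eventually_gt_at_top[of 0]
  proof eventually_elim
    case (elim n)
    then show ?case by (simp add: abs_mult field_simps)
  qed
qed

lemma cesaro_mean_tendsto:
  fixes X :: "nat \<Rightarrow> 'b::real_normed_vector"
  assumes X: "X \<longlonglongrightarrow> L"
  shows "(\<lambda>n. (\<Sum>k<n. X k) /\<^sub>R real n) \<longlonglongrightarrow> L"
proof (rule LIMSEQ_I)
  fix r :: real assume r: "r > 0"
  then obtain m where m: "\<And>k. k \<ge> m \<Longrightarrow> norm (X k - L) < r / 2"
    using LIMSEQ_D[OF X, of "r/2"] by auto
  define A where "A = (\<Sum>k<m. norm (X k - L))"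
  obtain n0 where n0: "2 * A / r < real n0"
    using reals_Archimedean2 by blast
  show "\<exists>no. \<forall>n\<ge>no. norm ((\<Sum>k<n. X k) /\<^sub>R real n - L) < r"
  proof (intro exI allI impI)
    fix n assume n: "n \<ge> max (Suc m) n0"
    then have npos: "real n > 0" by simp
    have "(\<Sum>k<n. X k) /\<^sub>R real n - L = (\<Sum>k<n. X k - L) /\<^sub>R real n"
      using npos by (simp add: sum_subtractf scaleR_diff_right sum_constant_scaleR)
    also have "norm \<dots> \<le> (\<Sum>k<n. norm (X k - L)) / real n"
      using npos by (simp add: divide_inverse mult.commute norm_sum mult_right_mono)
    also have "(\<Sum>k<n. norm (X k - L)) = A + (\<Sum>k=m..<n. norm (X k - L))"
      unfolding A_def using n by (subst sum.atLeastLessThan_concat[of 0 m n, symmetric, unfolded atLeast0LessThan]) auto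
    also have "\<dots> \<le> A + (\<Sum>k=m..<n. r / 2)"
      using m by (intro add_left_mono sum_mono) (auto intro: less_imp_le)
    also have "\<dots> \<le> A + real n * (r / 2)"
      using r by (auto intro!: mult_right_mono)
    also have "A < real n * (r / 2)"
    proof -
      have "2 * A / r < real n" using n0 n by linarith
      then show ?thesis using r by (simp add: field_simps)
    qed
    finally show "norm ((\<Sum>k<n. X k) /\<^sub>R real n - L) < r"
      using npos by (simp add: divide_strict_right_mono field_simps)
  qed
qed

text \<open>
  A deterministic trajectory of the urn: each step adds the current composition times \<open>H\<close>, and
  \<open>\<xi>\<close> collects the initial state and all fluctuations.
\<close>

locale driven_sequence =
  fixes H :: "real^'k^'k" and l :: real and p u :: "real^'k"
    and C \<xi> :: "nat \<Rightarrow> real^'k" and S :: "nat \<Rightarrow> real"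
  assumes irr: "irreducible_matrix H" and l_pos: "l > 0"
    and p_ev: "p v* H = l *\<^sub>R p" and p_pos: "\<And>i. 0 < p $ i" and p_sum: "(\<Sum>i\<in>UNIV. p $ i) = 1"
    and u_ev: "H *v u = l *\<^sub>R u" and u_pos: "\<And>i. 0 < u $ i"
    and S_eq: "\<And>n. S n = (\<Sum>i\<in>UNIV. C n $ i)"
    and C_nonneg: "\<And>n i. 0 \<le> C n $ i" and S_pos: "\<And>n. 0 < S n"
    and C_eq: "\<And>n. C n = \<xi> n + (\<Sum>k<n. C k /\<^sub>R S k) v* H"
    and \<xi>_sublinear: "(\<lambda>n. \<xi> n /\<^sub>R real n) \<longlonglongrightarrow> 0"
begin

lemma C_inner: "C n \<bullet> w = \<xi> n \<bullet> w + (\<Sum>k<n. (C k \<bullet> (H *v w)) / S k)"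
proof -
  have "C n \<bullet> w = \<xi> n \<bullet> w + (\<Sum>k<n. C k /\<^sub>R S k) \<bullet> (H *v w)"
    by (subst C_eq) (simp add: inner_add_left dot_lmul_matrix)
  then show ?thesis
    by (simp add: inner_sum_left divide_inverse mult.commute)
qed

text \<open>
  Up to the error, the product with the right eigenvector increases by at least a fixed amount per
  step.
\<close>

lemma S_linear_growth:
  obtains c where "c > 0" "eventually (\<lambda>n. c * real n \<le> S n) sequentially"
proof -
  define a b where "a = Min (range (($) u))" and "b = Max (range (($) u))"
  have "a \<in> range (($) u)" unfolding a_def by (rule Min_in) auto
  then have a: "a > 0" using u_pos by auto
  have au: "a \<le> u $ i" for i unfolding a_def by (rule Min_le) auto
  have ub: "u $ i \<le> b" for i unfolding b_def by (rule Max_ge) auto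
  have b: "b > 0" using u_pos[of undefined] ub[of undefined] by linarith
  have lower: "a * S n \<le> C n \<bullet> u" for n
    unfolding S_eq inner_vec_def sum_distrib_left
    using mult_right_mono[OF au C_nonneg[of n]] by (auto intro!: sum_mono simp: mult.commute)
  have upper: "C n \<bullet> u \<le> b * S n" for n
    unfolding S_eq inner_vec_def sum_distrib_left
    using mult_right_mono[OF ub C_nonneg[of n]] by (auto intro!: sum_mono simp: mult.commute)
  have "eventually (\<lambda>n. \<bar>\<xi> n \<bullet> u\<bar> \<le> (l * a / 2) * real n) sequentially"
    using l_pos a by (intro sublinear_inner[OF \<xi>_sublinear]) auto
  then have "eventually (\<lambda>n. l * a / (2 * b) * real n \<le> S n) sequentially"
  proof eventually_elim
    case (elim n)
    have "(\<Sum>k<n. l * a) \<le> (\<Sum>k<n. (C k \<bullet> (H *v u)) / S k)"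
    proof (rule sum_mono)
      fix k
      have "l * (a * S k) \<le> l * (C k \<bullet> u)"
        using lower[of k] l_pos by (intro mult_left_mono) auto
      then show "l * a \<le> (C k \<bullet> (H *v u)) / S k"
        using S_pos[of k] by (simp add: u_ev field_simps)
    qed
    then have "l * a / 2 * real n \<le> C n \<bullet> u"
      using elim C_inner[of n u] by (simp add: field_simps)
    also have "\<dots> \<le> b * S n" by (rule upper)
    finally show ?case using b by (simp add: field_simps)
  qed
  then show ?thesis
    using that[of "l * a / (2 * b)"] l_pos a b by simp
qed

text \<open>
  The lower limit of \<open>C n \<bullet> w / n\<close> is nonnegative. As \<open>S\<close> grows at least linearly, the same then
  holds for the composition tested against \<open>w\<close>.
\<close>

definition asymptotically_nonneg :: "real^'k \<Rightarrow> bool" where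
  "asymptotically_nonneg w \<longleftrightarrow>
     (\<forall>e>0. eventually (\<lambda>n. - e * real n \<le> C n \<bullet> w) sequentially)"

text \<open>
  With \<open>x n\<close> the value \<open>C n \<bullet> w\<close> up to the sublinear error, the recursion gives
  \<open>x (Suc n) \<ge> (1 - 1 / S n) * x n - e\<close> for every \<open>e > 0\<close> and large \<open>n\<close>: the factor can
  only raise a negative value, so \<open>x\<close> stays above a line of slope \<open>- e\<close>.
\<close>

lemma asymptotically_nonneg_pullback:
  assumes "asymptotically_nonneg (w + H *v w)"
  shows "asymptotically_nonneg w"
  unfolding asymptotically_nonneg_def
proof (intro allI impI)
  fix e :: real assume e: "e > 0"
  obtain c where c: "c > 0" "eventually (\<lambda>n. c * real n \<le> S n) sequentially"
    by (rule S_linear_growth)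
  \<comment> \<open>At accuracy \<open>d\<close> the recursion loses at most \<open>2 * d * n / S n \<le> 2 * d / c \<le> e / 4\<close> per step.\<close>
  define d where "d = min (e / 4) (e * c / 8)"
  have d: "d > 0" "d \<le> e / 4" "2 * d / c \<le> e / 4" 
    using e c by (auto simp: d_def field_simps)
  obtain N0 where N0: "\<And>n. n \<ge> N0 \<Longrightarrow> c * real n \<le> S n \<and> - d * real n \<le> C n \<bullet> (w + H *v w) \<and>
      \<bar>\<xi> n \<bullet> w\<bar> \<le> d * real n \<and> 1 / c \<le> real n"
  proof -
    have "eventually (\<lambda>n. c * real n \<le> S n \<and> - d * real n \<le> C n \<bullet> (w + H *v w) \<and>
      \<bar>\<xi> n \<bullet> w\<bar> \<le> d * real n \<and> 1 / c \<le> real n) sequentially"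
      using assms d(1) unfolding asymptotically_nonneg_def
      by (intro eventually_conj c(2) sublinear_inner[OF \<xi>_sublinear]
            eventually_compose_filterlim[OF eventually_ge_at_top filterlim_real_sequentially]) auto
    then show ?thesis using that by (auto simp: eventually_sequentially)
  qed
  define x where "x n = (\<Sum>k<n. (C k \<bullet> (H *v w)) / S k)" for n
  define K where "K = \<bar>x N0\<bar>"
  have x: "- (e / 4) * real n - K \<le> x n" if "n \<ge> N0" for n
    using that
  proof (induction n rule: dec_induct)
    case base
    show ?case using e by (simp add: K_def) (smt (verit) divide_nonneg_nonneg mult_nonneg_nonneg of_nat_0_le_iff)
  next
    case (step n)
    note N = N0[OF step(1)]
    have S1: "S n \<ge> 1" using N c(1) by (smt (verit) mult.commute pos_divide_le_eq)
    have "C n \<bullet> (H *v w) \<ge> - d * real n - C n \<bullet> w"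
      using N by (simp add: inner_add_right)
    moreover have "C n \<bullet> w = x n + \<xi> n \<bullet> w"
      unfolding x_def using C_inner[of n w] by simp
    ultimately have "C n \<bullet> (H *v w) \<ge> - 2 * d * real n - x n"
      using N by linarith
    moreover have "2 * d * real n \<le> e / 4 * S n"
    proof -
      have "2 * d * real n = 2 * d / c * (c * real n)" using c(1) by simp
      also have "\<dots> \<le> e / 4 * S n"
        using d N c(1) e by (intro mult_mono) auto
      finally show ?thesis .
    qed
    ultimately have "- (e / 4) * S n - x n \<le> C n \<bullet> (H *v w)"
      by linarith
    then have "(- (e / 4) * S n - x n) / S n \<le> (C n \<bullet> (H *v w)) / S n"
      using S1 by (intro divide_right_mono) auto
    then have "- (e / 4) - x n / S n \<le> (C n \<bullet> (H *v w)) / S n"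
      using S1 by (simp add: diff_divide_distrib)
    then have "(1 - 1 / S n) * x n - e / 4 \<le> x (Suc n)"
      by (simp add: x_def left_diff_distrib)
    moreover have "- (e / 4) * real n - K \<le> (1 - 1 / S n) * x n"
    proof -
      have "(1 - 1 / S n) * (- (e / 4) * real n - K) \<le> (1 - 1 / S n) * x n"
        using step.IH S1 by (intro mult_left_mono) auto
      moreover have "0 \<le> (1 / S n) * (e / 4 * real n + K)"
        using S1 e by (intro mult_nonneg_nonneg add_nonneg_nonneg) (auto simp: K_def)
      moreover have "(1 - 1 / S n) * (- (e / 4) * real n - K)
          = - (e / 4) * real n - K + (1 / S n) * (e / 4 * real n + K)"
      proof -
        have "(1 - r) * (- (e / 4) * y - K) = - (e / 4) * y - K + r * (e / 4 * y + K)" for r y :: real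
          by (simp add: field_simps)
        then show ?thesis .
      qed
      ultimately show ?thesis by linarith
    qed
    ultimately show ?case by (simp add: field_simps)
  qed
  have "eventually (\<lambda>n. 4 * K / e \<le> real n) sequentially"
    by (intro eventually_compose_filterlim[OF eventually_ge_at_top filterlim_real_sequentially])
  then show "eventually (\<lambda>n. - e * real n \<le> C n \<bullet> w) sequentially"
    using eventually_ge_at_top[of N0]
  proof eventually_elim
    case (elim n)
    have "K \<le> e / 4 * real n" using elim(1) e by (simp add: field_simps)
    moreover have "d * real n \<le> e / 4 * real n" using d by (intro mult_right_mono) auto
    moreover have "0 \<le> e * real n" using e by simp
    moreover have "C n \<bullet> w = x n + \<xi> n \<bullet> w"
      unfolding x_def using C_inner[of n w] by simp
    ultimately show ?case using x[OF elim(2)] N0[OF elim(2)] by simp linarith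
  qed
qed

lemma asymptotically_nonneg_of_pos:
  assumes "p \<bullet> w > 0"
  shows "asymptotically_nonneg w"
proof -
  obtain m where m: "\<And>i. 0 \<le> ((\<lambda>v. v + H *v v) ^^ m) w $ i"
    using irreducible_iterates_eventually_nonneg[OF irr p_ev p_pos u_ev u_pos assms] by blast
  have "asymptotically_nonneg v" if "\<And>i. 0 \<le> v $ i" for v
  proof -
    have "0 \<le> C n \<bullet> v" for n
      unfolding inner_vec_def by (auto intro!: sum_nonneg mult_nonneg_nonneg C_nonneg that)
    moreover have "- e * real n \<le> 0" if "e > 0" for e n
      using that by simp
    ultimately show ?thesis
      unfolding asymptotically_nonneg_def
      by (meson always_eventually order_trans)
  qed
  then have "asymptotically_nonneg (((\<lambda>v. v + H *v v) ^^ m) w)"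
    using m by blast
  then show ?thesis
    by (induction m) (auto dest: asymptotically_nonneg_pullback)
qed

text \<open>
  Both \<open>w\<close> and \<open>- w\<close> become admissible in the previous lemma after adding a small multiple of the
  vector of ones, whose product with \<open>C n\<close> is \<open>S n\<close>.
\<close>

lemma orthogonal_component_vanishes:
  assumes "p \<bullet> w = 0"
  shows "(\<lambda>n. (C n \<bullet> w) / S n) \<longlonglongrightarrow> 0"
proof -
  have lower: "eventually (\<lambda>n. - e < (C n \<bullet> w) / S n) sequentially"
    if e: "e > 0" and w: "p \<bullet> w = 0" for e w
  proof -
    obtain c where c: "c > 0" "eventually (\<lambda>n. c * real n \<le> S n) sequentially"
      by (rule S_linear_growth)
    let ?v = "w + (e / 4) *\<^sub>R 1"
    have one: "x \<bullet> (1 :: real^'k) = (\<Sum>i\<in>UNIV. x $ i)" for x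
      by (simp add: inner_vec_def)
    have "p \<bullet> ?v > 0" using w e by (simp add: inner_add_right one p_sum)
    then have "asymptotically_nonneg ?v" by (rule asymptotically_nonneg_of_pos)
    then have "eventually (\<lambda>n. - (e * c / 4) * real n \<le> C n \<bullet> ?v) sequentially"
      using e c(1) unfolding asymptotically_nonneg_def by (metis divide_pos_pos mult_pos_pos zero_less_numeral)
    with c(2) show ?thesis
    proof eventually_elim
      case (elim n)
      have "e / 4 * (c * real n) \<le> e / 4 * S n"
        using elim(1) e by (intro mult_left_mono) auto
      moreover have "0 < e * S n" using e S_pos by simp
      moreover have "C n \<bullet> ?v = C n \<bullet> w + e / 4 * S n"
        by (simp add: inner_add_right one S_eq)
      ultimately have "- e * S n < C n \<bullet> w" using elim(2) by simp
      then show ?case using S_pos[of n] by (simp add: field_simps)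
    qed
  qed
  show ?thesis
  proof (rule tendstoI)
    fix e :: real assume e: "e > 0"
    have "p \<bullet> (- w) = 0" using assms by simp
    from lower[OF e assms] lower[OF e this]
    show "eventually (\<lambda>n. dist ((C n \<bullet> w) / S n) 0 < e) sequentially"
      by eventually_elim (auto simp: abs_less_iff)
  qed
qed

theorem composition_tendsto: "(\<lambda>n. C n /\<^sub>R S n) \<longlonglongrightarrow> p"
proof (rule vec_tendstoI)
  fix i
  let ?w = "axis i 1 - (p $ i) *\<^sub>R 1 :: real^'k"
  have w: "x \<bullet> ?w = x $ i - p $ i * (\<Sum>j\<in>UNIV. x $ j)" for x
    by (simp add: inner_diff_right inner_axis) (simp add: inner_vec_def)
  have "(C n \<bullet> ?w) / S n = (C n /\<^sub>R S n) $ i - p $ i" for n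
    using S_pos[of n] by (simp only: w S_eq[symmetric]) (simp add: field_simps)
  then have "(\<lambda>n. (C n /\<^sub>R S n) $ i - p $ i) \<longlonglongrightarrow> 0"
    using orthogonal_component_vanishes[of ?w] w[of p] by (simp add: p_sum)
  then show "(\<lambda>n. (C n /\<^sub>R S n) $ i) \<longlonglongrightarrow> p $ i"
    by (simp add: LIM_zero_iff)
qed

end

section \<open>Convergence almost surely and in mean\<close>

context prob_space
begin

lemma converges_as_and_L1_bounded:
  fixes X :: "nat \<Rightarrow> 'a \<Rightarrow> 'b::{banach, second_countable_topology}"
  assumes [measurable]: "\<And>n. X n \<in> borel_measurable M"
    and bound: "\<And>n. AE \<omega> in M. norm (X n \<omega>) \<le> K"
    and lim: "AE \<omega> in M. (\<lambda>n. X n \<omega>) \<longlonglongrightarrow> c"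
  shows "converges_as_and_L1 M X c"
proof -
  have int: "integrable M (X n)" for n
    by (rule integrable_const_bound[OF bound]) simp
  have "(\<lambda>n. \<integral>\<omega>. norm (X n \<omega> - c) \<partial>M) \<longlonglongrightarrow> (\<integral>\<omega>. 0 \<partial>M)"
  proof (rule integral_dominated_convergence)
    show "AE \<omega> in M. (\<lambda>n. norm (X n \<omega> - c)) \<longlonglongrightarrow> 0"
      using lim by eventually_elim (simp add: tendsto_norm_zero LIM_zero)
    show "AE \<omega> in M. norm (norm (X n \<omega> - c)) \<le> K + norm c" for n
      using bound[of n] by eventually_elim (auto intro!: order_trans[OF norm_triangle_ineq4])
  qed auto
  then show ?thesis
    using lim int by (auto simp: converges_as_and_L1_def)
qed

lemma converges_as_and_L1_linear:
  fixes X :: "nat \<Rightarrow> 'a \<Rightarrow> 'b::{banach, second_countable_topology}"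
    and f :: "'b \<Rightarrow> 'c::{banach, second_countable_topology}"
  assumes f: "bounded_linear f" and X: "converges_as_and_L1 M X c"
  shows "converges_as_and_L1 M (\<lambda>n \<omega>. f (X n \<omega>)) (f c)"
proof -
  interpret f: bounded_linear f by (rule f)
  obtain K where K: "\<And>x. norm (f x) \<le> norm x * K" using f.bounded by blast
  have int: "integrable M (X n)" for n using X by (simp add: converges_as_and_L1_def)
  then have intf: "integrable M (\<lambda>\<omega>. f (X n \<omega>))" for n by (intro integrable_bounded_linear[OF f])
  have "(\<lambda>n. \<integral>\<omega>. norm (f (X n \<omega>) - f c) \<partial>M) \<longlonglongrightarrow> 0"
  proof (rule Lim_null_comparison[OF always_eventually])
    show "\<forall>n. norm (\<integral>\<omega>. norm (f (X n \<omega>) - f c) \<partial>M) \<le> (\<integral>\<omega>. norm (X n \<omega> - c) \<partial>M) * K"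
    proof
      fix n
      have "(\<integral>\<omega>. norm (f (X n \<omega>) - f c) \<partial>M) \<le> (\<integral>\<omega>. norm (X n \<omega> - c) * K \<partial>M)"
        by (rule integral_mono) (use int intf K[of "X n _ - c"] in \<open>auto simp: f.diff\<close>)
      then show "norm (\<integral>\<omega>. norm (f (X n \<omega>) - f c) \<partial>M) \<le> (\<integral>\<omega>. norm (X n \<omega> - c) \<partial>M) * K"
        by simp
    qed
    show "(\<lambda>n. (\<integral>\<omega>. norm (X n \<omega> - c) \<partial>M) * K) \<longlonglongrightarrow> 0"
      using X by (intro tendsto_mult_left_zero) (simp add: converges_as_and_L1_def)
  qed
  moreover have "AE \<omega> in M. (\<lambda>n. f (X n \<omega>)) \<longlonglongrightarrow> f c"
    using X unfolding converges_as_and_L1_def by (auto intro: f.tendsto elim!: eventually_mono)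
  ultimately show ?thesis
    using intf by (simp add: converges_as_and_L1_def)
qed

lemma converges_as_and_L1_add:
  fixes X Y :: "nat \<Rightarrow> 'a \<Rightarrow> 'b::{banach, second_countable_topology}"
  assumes X: "converges_as_and_L1 M X c" and Y: "converges_as_and_L1 M Y d"
  shows "converges_as_and_L1 M (\<lambda>n \<omega>. X n \<omega> + Y n \<omega>) (c + d)"
proof -
  have int: "integrable M (X n)" "integrable M (Y n)" for n
    using X Y by (auto simp: converges_as_and_L1_def)
  have "(\<lambda>n. \<integral>\<omega>. norm (X n \<omega> + Y n \<omega> - (c + d)) \<partial>M) \<longlonglongrightarrow> 0"
  proof (rule Lim_null_comparison[OF always_eventually])
    show "\<forall>n. norm (\<integral>\<omega>. norm (X n \<omega> + Y n \<omega> - (c + d)) \<partial>M)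
        \<le> (\<integral>\<omega>. norm (X n \<omega> - c) \<partial>M) + (\<integral>\<omega>. norm (Y n \<omega> - d) \<partial>M)"
    proof
      fix n
      have "(\<integral>\<omega>. norm (X n \<omega> + Y n \<omega> - (c + d)) \<partial>M)
          \<le> (\<integral>\<omega>. norm (X n \<omega> - c) + norm (Y n \<omega> - d) \<partial>M)"
      proof (rule integral_mono)
        show "norm (X n \<omega> + Y n \<omega> - (c + d)) \<le> norm (X n \<omega> - c) + norm (Y n \<omega> - d)" for \<omega>
          using norm_triangle_ineq[of "X n \<omega> - c" "Y n \<omega> - d"] by (simp add: algebra_simps)
      qed (use int in auto)
      then show "norm (\<integral>\<omega>. norm (X n \<omega> + Y n \<omega> - (c + d)) \<partial>M)
        \<le> (\<integral>\<omega>. norm (X n \<omega> - c) \<partial>M) + (\<integral>\<omega>. norm (Y n \<omega> - d) \<partial>M)"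
        using int by simp
    qed
    show "(\<lambda>n. (\<integral>\<omega>. norm (X n \<omega> - c) \<partial>M) + (\<integral>\<omega>. norm (Y n \<omega> - d) \<partial>M)) \<longlonglongrightarrow> 0"
      using X Y by (intro tendsto_add_zero) (simp_all add: converges_as_and_L1_def)
  qed
  moreover have "AE \<omega> in M. (\<lambda>n. X n \<omega> + Y n \<omega>) \<longlonglongrightarrow> c + d"
  proof -
    have "AE \<omega> in M. (\<lambda>n. X n \<omega>) \<longlonglongrightarrow> c" "AE \<omega> in M. (\<lambda>n. Y n \<omega>) \<longlonglongrightarrow> d"
      using X Y by (simp_all add: converges_as_and_L1_def)
    then show ?thesis by eventually_elim (rule tendsto_add)
  qed
  ultimately show ?thesis
    using int by (simp add: converges_as_and_L1_def)
qed

lemma converges_as_and_L1_sum: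
  fixes X :: "'i \<Rightarrow> nat \<Rightarrow> 'a \<Rightarrow> 'b::{banach, second_countable_topology}"
  assumes "finite I" "\<And>i. i \<in> I \<Longrightarrow> converges_as_and_L1 M (X i) (c i)"
  shows "converges_as_and_L1 M (\<lambda>n \<omega>. \<Sum>i\<in>I. X i n \<omega>) (\<Sum>i\<in>I. c i)"
  using assms
proof (induction I rule: finite_induct)
  case empty
  then show ?case by (simp add: converges_as_and_L1_def)
next
  case (insert i I)
  then show ?case
    using converges_as_and_L1_add[of "X i" "c i" "\<lambda>n \<omega>. \<Sum>i\<in>I. X i n \<omega>" "\<Sum>i\<in>I. c i"] by simp
qed

lemma converges_as_and_L1_cong:
  fixes X Y :: "nat \<Rightarrow> 'a \<Rightarrow> 'b::{banach, second_countable_topology}"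
  assumes X: "converges_as_and_L1 M X c"
    and Y: "\<And>n. Y n \<in> borel_measurable M" "\<And>n. AE \<omega> in M. X n \<omega> = Y n \<omega>"
  shows "converges_as_and_L1 M Y c"
proof -
  have int: "integrable M (X n)" for n
    using X by (simp add: converges_as_and_L1_def)
  have intY: "integrable M (Y n)" for n
    using Y(1) Y(2)[of n] int[of n] by (subst integrable_cong_AE[of _ _ "X n"]) (auto elim!: eventually_mono)
  have "(\<integral>\<omega>. norm (Y n \<omega> - c) \<partial>M) = (\<integral>\<omega>. norm (X n \<omega> - c) \<partial>M)" for n
    using Y(1) Y(2)[of n] int[of n] by (intro integral_cong_AE) (auto elim!: eventually_mono)
  moreover have "AE \<omega> in M. \<forall>n. X n \<omega> = Y n \<omega>"
    using Y(2) by (simp add: AE_all_countable)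
  then have "AE \<omega> in M. (\<lambda>n. Y n \<omega>) \<longlonglongrightarrow> c"
    using X[unfolded converges_as_and_L1_def, THEN conjunct1] by eventually_elim simp
  ultimately show ?thesis
    using X intY by (simp add: converges_as_and_L1_def)
qed

section \<open>Strong laws of large numbers\<close>

text \<open>The sum of the sequence has finite expectation, hence converges almost surely.\<close>

lemma AE_tendsto_zero_if_expectations_summable:
  fixes f :: "nat \<Rightarrow> 'a \<Rightarrow> real"
  assumes int: "\<And>n. integrable M (f n)" and nn: "\<And>n \<omega>. 0 \<le> f n \<omega>"
    and bound: "\<And>n. (\<Sum>j<n. expectation (f j)) \<le> B"
  shows "AE \<omega> in M. (\<lambda>n. f n \<omega>) \<longlonglongrightarrow> 0"
proof -
  have [measurable]: "f n \<in> borel_measurable M" for n using int by auto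
  have "(\<integral>\<^sup>+\<omega>. (\<Sum>n. ennreal (f n \<omega>)) \<partial>M) = (\<Sum>n. \<integral>\<^sup>+\<omega>. ennreal (f n \<omega>) \<partial>M)"
    by (rule nn_integral_suminf) simp
  also have "\<dots> = (\<Sum>n. ennreal (expectation (f n)))"
    using int nn by (simp add: nn_integral_eq_integral)
  also have "\<dots> \<le> ennreal B"
    unfolding suminf_eq_SUP
    by (rule SUP_least) (use bound nn in \<open>auto simp: sum_ennreal integral_nonneg_AE intro: ennreal_leI\<close>)
  finally have "(\<integral>\<^sup>+\<omega>. (\<Sum>n. ennreal (f n \<omega>)) \<partial>M) \<noteq> \<infinity>"
    by (auto simp: top_unique)
  then have "AE \<omega> in M. (\<Sum>n. ennreal (f n \<omega>)) \<noteq> \<infinity>"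
    by (intro nn_integral_PInf_AE) auto
  then show ?thesis
    by eventually_elim (auto intro!: summable_LIMSEQ_zero summable_suminf_not_top nn)
qed

lemma second_moment_sum_uncorrelated:
  fixes D :: "nat \<Rightarrow> 'a \<Rightarrow> real"
  assumes int: "\<And>j k. integrable M (\<lambda>\<omega>. D j \<omega> * D k \<omega>)"
    and uncor: "\<And>j k. j < k \<Longrightarrow> expectation (\<lambda>\<omega>. D j \<omega> * D k \<omega>) = 0"
  shows "integrable M (\<lambda>\<omega>. (\<Sum>k<n. D k \<omega>)\<^sup>2)"
    and "expectation (\<lambda>\<omega>. (\<Sum>k<n. D k \<omega>)\<^sup>2) = (\<Sum>k<n. expectation (\<lambda>\<omega>. (D k \<omega>)\<^sup>2))"
proof (induction n)
  case (Suc n)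
  have eq: "(\<Sum>k<Suc n. D k \<omega>)\<^sup>2
      = (\<Sum>k<n. D k \<omega>)\<^sup>2 + 2 * (\<Sum>k<n. D k \<omega> * D n \<omega>) + D n \<omega> * D n \<omega>" for \<omega>
    by (simp add: power2_sum sum_distrib_left power2_eq_square algebra_simps)
  {
    case 1
    then show ?case
      unfolding eq using Suc int by (intro Bochner_Integration.integrable_add integrable_mult_right Bochner_Integration.integrable_sum) auto
  next
    case 2
    then show ?case
      unfolding eq using Suc int
      by (subst Bochner_Integration.integral_add | intro Bochner_Integration.integrable_add Bochner_Integration.integrable_sum integrable_mult_right | assumption | simp add: uncor power2_eq_square)+
  }
qed auto

lemma floor_sqrt_at_top: "filterlim floor_sqrt at_top sequentially"
  unfolding filterlim_at_top le_floor_sqrt_iff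
  by (auto intro: eventually_ge_at_top)

lemma bounded_mean_tendsto_from_squares:
  fixes d :: "nat \<Rightarrow> real"
  assumes bound: "\<And>k. \<bar>d k\<bar> \<le> c"
    and lim: "(\<lambda>m. (\<Sum>k<m\<^sup>2. d k) / real (m\<^sup>2)) \<longlonglongrightarrow> 0"
  shows "(\<lambda>n. (\<Sum>k<n. d k) / real n) \<longlonglongrightarrow> 0"
proof (rule Lim_null_comparison)
  let ?h = "\<lambda>m. \<bar>(\<Sum>k<m\<^sup>2. d k) / real (m\<^sup>2)\<bar> + 2 * c / real m"
  have "?h \<longlonglongrightarrow> 0"
    by (intro tendsto_add_zero tendsto_rabs_zero lim tendsto_divide_0[OF tendsto_const]
          filterlim_at_top_imp_at_infinity filterlim_real_sequentially)
  then show "(\<lambda>n. ?h (floor_sqrt n)) \<longlonglongrightarrow> 0"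
    by (rule filterlim_compose[OF _ floor_sqrt_at_top])
  have c: "c \<ge> 0" using bound[of 0] by linarith
  show "eventually (\<lambda>n. norm ((\<Sum>k<n. d k) / real n) \<le> ?h (floor_sqrt n)) sequentially"
    using eventually_gt_at_top[of 0]
  proof eventually_elim
    case (elim n)
    define m where "m = floor_sqrt n"
    have m: "m > 0" "m\<^sup>2 \<le> n" using elim by (auto simp: m_def)
    have "n < (Suc m)\<^sup>2" unfolding m_def by (rule Suc_floor_sqrt_power2_gt)
    then have n_le: "n - m\<^sup>2 \<le> 2 * m" by (simp add: power2_eq_square)
    have "(\<Sum>k<n. d k) = (\<Sum>k<m\<^sup>2. d k) + (\<Sum>k=m\<^sup>2..<n. d k)"
      using m(2) by (metis atLeast0LessThan le0 sum.atLeastLessThan_concat)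
    moreover have "\<bar>\<Sum>k=m\<^sup>2..<n. d k\<bar> \<le> (\<Sum>k=m\<^sup>2..<n. c)"
      by (rule order_trans[OF sum_abs sum_mono]) (rule bound)
    moreover have "(\<Sum>k=m\<^sup>2..<n. c) \<le> 2 * real m * c"
      using n_le c by (auto intro!: mult_right_mono simp flip: of_nat_diff)
    ultimately have "\<bar>\<Sum>k<n. d k\<bar> \<le> \<bar>\<Sum>k<m\<^sup>2. d k\<bar> + 2 * real m * c"
      by linarith
    then have "\<bar>\<Sum>k<n. d k\<bar> / real n \<le> (\<bar>\<Sum>k<m\<^sup>2. d k\<bar> + 2 * real m * c) / real n"
      by (intro divide_right_mono) auto
    also have "\<dots> \<le> (\<bar>\<Sum>k<m\<^sup>2. d k\<bar> + 2 * real m * c) / real (m\<^sup>2)"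
      using m c elim by (intro divide_left_mono mult_pos_pos add_nonneg_nonneg) (auto simp del: of_nat_power)
    also have "\<dots> = ?h m"
      using m(1) by (simp add: add_divide_distrib power2_eq_square abs_divide)
    finally show ?case by (simp add: m_def)
  qed
qed

text \<open>
  Orthogonality bounds the second moment of the mean of \<open>n\<close> terms by \<open>c\<^sup>2 / n\<close>, which is summable
  along the squares; boundedness controls the mean between two squares.
\<close>

lemma strong_law_bounded_uncorrelated:
  fixes D :: "nat \<Rightarrow> 'a \<Rightarrow> real"
  assumes [measurable]: "\<And>k. D k \<in> borel_measurable M"
    and bound: "\<And>k. AE \<omega> in M. \<bar>D k \<omega>\<bar> \<le> c"
    and uncor: "\<And>j k. j < k \<Longrightarrow> expectation (\<lambda>\<omega>. D j \<omega> * D k \<omega>) = 0"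
  shows "converges_as_and_L1 M (\<lambda>n \<omega>. (\<Sum>k<n. D k \<omega>) / real n) 0"
proof -
  have all: "AE \<omega> in M. \<forall>k. \<bar>D k \<omega>\<bar> \<le> c"
    using bound by (simp add: AE_all_countable)
  have c: "c \<ge> 0"
  proof (rule ccontr)
    assume "\<not> c \<ge> 0"
    then have "\<not> \<bar>x\<bar> \<le> c" for x by linarith
    then show False using bound[of 0] by simp
  qed
  have prod_bound: "AE \<omega> in M. norm (D j \<omega> * D k \<omega>) \<le> c * c" for j k
    using all by eventually_elim (auto simp: abs_mult intro!: mult_mono c)
  have int: "integrable M (\<lambda>\<omega>. D j \<omega> * D k \<omega>)" for j k
    by (rule integrable_const_bound[OF prod_bound]) simp
  note mom = second_moment_sum_uncorrelated[of D, OF int uncor]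
  define f where "f m \<omega> = ((\<Sum>k<m\<^sup>2. D k \<omega>) / real (m\<^sup>2))\<^sup>2" for m \<omega>
  have f_int: "integrable M (f m)" for m
    unfolding f_def power_divide by (intro integrable_divide mom(1))
  have f_exp: "expectation (f m) \<le> c\<^sup>2 * inverse (real m ^ 2)" for m
  proof -
    have "expectation (\<lambda>\<omega>. (D k \<omega>)\<^sup>2) \<le> c\<^sup>2" for k
    proof -
      have "expectation (\<lambda>\<omega>. (D k \<omega>)\<^sup>2) \<le> expectation (\<lambda>\<omega>. c\<^sup>2)"
        by (rule integral_mono_AE)
           (use int[of k k] prod_bound[of k k] in \<open>auto simp: power2_eq_square elim!: eventually_mono\<close>)
      then show ?thesis by (simp add: prob_space)
    qed
    then have "(\<Sum>k<m\<^sup>2. expectation (\<lambda>\<omega>. (D k \<omega>)\<^sup>2)) \<le> (\<Sum>k<m\<^sup>2. c\<^sup>2)"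
      by (intro sum_mono)
    then have "expectation (f m) \<le> (real (m\<^sup>2) * c\<^sup>2) / (real (m\<^sup>2))\<^sup>2"
      unfolding f_def power_divide using mom(2)[of "m\<^sup>2"] 
      by (simp add: divide_right_mono)
    also have "\<dots> = c\<^sup>2 * inverse (real m ^ 2)"
      by (simp add: power2_eq_square field_simps)
    finally show ?thesis .
  qed
  have "AE \<omega> in M. (\<lambda>m. f m \<omega>) \<longlonglongrightarrow> 0"
  proof (rule AE_tendsto_zero_if_expectations_summable[OF f_int])
    fix n
    have "(\<Sum>j<n. expectation (f j)) \<le> (\<Sum>j<n. c\<^sup>2 * inverse (real j ^ 2))"
      by (intro sum_mono f_exp)
    also have "\<dots> \<le> (\<Sum>j. c\<^sup>2 * inverse (real j ^ 2))"
      by (intro sum_le_suminf summable_mult inverse_power_summable) auto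
    finally show "(\<Sum>j<n. expectation (f j)) \<le> (\<Sum>j. c\<^sup>2 * inverse (real j ^ 2))" .
  qed (simp add: f_def)
  then have lim: "AE \<omega> in M. (\<lambda>n. (\<Sum>k<n. D k \<omega>) / real n) \<longlonglongrightarrow> 0"
    using all
  proof eventually_elim
    case (elim \<omega>)
    have "(\<lambda>m. sqrt (f m \<omega>)) \<longlonglongrightarrow> sqrt 0"
      using elim(1) by (rule tendsto_real_sqrt)
    then have "(\<lambda>m. (\<Sum>k<m\<^sup>2. D k \<omega>) / real (m\<^sup>2)) \<longlonglongrightarrow> 0"
      unfolding f_def real_sqrt_abs real_sqrt_zero by (rule tendsto_rabs_zero_cancel)
    then show ?case
      using elim(2) by (intro bounded_mean_tendsto_from_squares) auto
  qed
  show ?thesis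
  proof (rule converges_as_and_L1_bounded[OF _ _ lim])
    show "AE \<omega> in M. norm ((\<Sum>k<n. D k \<omega>) / real n) \<le> c" for n
      using all
    proof eventually_elim
      case (elim \<omega>)
      have "\<bar>\<Sum>k<n. D k \<omega>\<bar> \<le> (\<Sum>k<n. c)"
        using elim by (intro order_trans[OF sum_abs sum_mono]) auto
      then show ?case using c by (cases "n = 0") (auto simp: field_simps)
    qed
  qed simp
qed


lemma dyadic_truncated_square_sum_le:
  assumes "(x::real) \<ge> 0"
  shows "(\<Sum>j<n. (if x \<le> 2 ^ j then x else 0)\<^sup>2 / 2 ^ j) \<le> 2 * x"
proof -
  \<comment> \<open>The terms with \<open>2 ^ j < x\<close> vanish and the others form a geometric series with ratio \<open>1/2\<close>, of
    which \<open>2 * x\<^sup>2 / 2 ^ n\<close> is the tail that the induction keeps in reserve.\<close>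
  have "(\<Sum>j<n. (if x \<le> 2 ^ j then x else 0)\<^sup>2 / 2 ^ j) \<le> (if x \<le> 2 ^ n then 2 * x - 2 * x\<^sup>2 / 2 ^ n else 0)"
  proof (induction n)
    case 0
    have "x\<^sup>2 \<le> x" if "x \<le> 1" using that assms by (simp add: power2_eq_square mult_left_le)
    then show ?case by auto
  next
    case (Suc n)
    define s where "s = (\<Sum>j<n. (if x \<le> 2 ^ j then x else 0)\<^sup>2 / 2 ^ j)"
    have split: "(\<Sum>j<Suc n. (if x \<le> 2 ^ j then x else 0)\<^sup>2 / 2 ^ j)
        = s + (if x \<le> 2 ^ n then x\<^sup>2 / 2 ^ n else 0)"
      by (simp add: s_def)
    note IH = Suc[folded s_def]
    have half: "2 * x\<^sup>2 / 2 ^ Suc n = x\<^sup>2 / 2 ^ n" by simp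
    have mono: "(2::real) ^ n \<le> 2 ^ Suc n" by simp
    consider "x \<le> 2 ^ n" | "\<not> x \<le> 2 ^ n" "x \<le> 2 ^ Suc n" | "\<not> x \<le> 2 ^ Suc n" by linarith
    then show ?case
    proof cases
      case 1
      then have "x \<le> 2 ^ Suc n" using mono by linarith
      moreover have "s \<le> 2 * x - 2 * (x\<^sup>2 / 2 ^ n)" using IH 1 by simp
      ultimately show ?thesis unfolding split half using 1 by (simp del: power_Suc)
    next
      case 2
      have "x\<^sup>2 \<le> x * 2 ^ Suc n"
        unfolding power2_eq_square using 2(2) assms by (rule mult_left_mono)
      then have "2 * x\<^sup>2 / 2 ^ Suc n \<le> 2 * x"
        by (simp add: divide_le_eq)
      moreover have "s \<le> 0" using IH 2 by simp
      ultimately show ?thesis unfolding split using 2 by (simp del: power_Suc)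
    next
      case 3
      then have "\<not> x \<le> 2 ^ n" using mono by linarith
      then show ?thesis unfolding split using IH 3 by (simp del: power_Suc)
    qed
  qed
  also have "\<dots> \<le> 2 * x" using assms by simp
  finally show ?thesis .
qed

lemma dyadic_exceedance_sum_le:
  assumes "(x::real) \<ge> 0"
  shows "(\<Sum>j<n. if x \<le> 2 ^ j then 0 else 2 ^ j) \<le> 2 * x"
proof -
  \<comment> \<open>A new term \<open>2 ^ n < x\<close> raises the sum to less than \<open>2 * 2 ^ n\<close>, hence to less than \<open>2 * x\<close>.\<close>
  have "(\<Sum>j<n. if x \<le> 2 ^ j then 0 else 2 ^ j) \<le> min (2 ^ n - 1) (2 * x)"
  proof (induction n)
    case 0
    then show ?case using assms by simp
  next
    case (Suc n)
    define s :: real where "s = (\<Sum>j<n. if x \<le> 2 ^ j then 0 else 2 ^ j)"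
    have "s \<le> 2 ^ n - 1" "s \<le> 2 * x"
      using Suc by (simp_all add: s_def)
    moreover have "(0::real) < 2 ^ n" "(2::real) ^ Suc n = 2 ^ n + 2 ^ n" by simp_all
    ultimately have "s + (if x \<le> 2 ^ n then 0 else 2 ^ n) \<le> 2 ^ Suc n - 1"
      "s + (if x \<le> 2 ^ n then 0 else 2 ^ n) \<le> 2 * x"
      by (cases "x \<le> 2 ^ n"; simp only: if_True if_False; linarith)+
    then show ?case by (simp add: s_def)
  qed
  then show ?thesis by simp
qed

lemma identically_distributed_expectation:
  fixes X Y :: "'a \<Rightarrow> real"
  assumes [measurable]: "X \<in> borel_measurable M" "Y \<in> borel_measurable M" "g \<in> borel_measurable borel"
    and "distr M borel X = distr M borel Y"
  shows "expectation (\<lambda>\<omega>. g (X \<omega>)) = (expectation (\<lambda>\<omega>. g (Y \<omega>)) :: real)"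
    and "integrable M (\<lambda>\<omega>. g (X \<omega>)) \<longleftrightarrow> integrable M (\<lambda>\<omega>. g (Y \<omega>))"
  using assms(4) by (simp_all flip: integral_distr[of _ M borel g] integrable_distr_eq[of _ M borel g])

text \<open>
  Only an upper bound is needed, up to a constant factor, so it suffices to control the means along
  the powers of two. There all terms are truncated at the common level \<open>2 ^ j\<close>: the variances
  of the truncated means and the expected numbers of terms changed by the truncation are both
  summable, by the two dyadic sums above.
\<close>

lemma nonneg_iid_mean_eventually_le:
  fixes X :: "nat \<Rightarrow> 'a \<Rightarrow> real"
  assumes X [measurable]: "\<And>k. X k \<in> borel_measurable M"
    and nn: "\<And>k \<omega>. 0 \<le> X k \<omega>"
    and ident: "\<And>k. distr M borel (X k) = distr M borel (X 0)"
    and indep: "\<And>j k. j < k \<Longrightarrow> indep_var borel (X j) borel (X k)"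
    and int: "integrable M (X 0)" and c: "expectation (X 0) < c"
  shows "AE \<omega> in M. eventually (\<lambda>n. (\<Sum>k<n. X k \<omega>) \<le> 2 * c * real n) sequentially"
proof -
  define T :: "nat \<Rightarrow> real \<Rightarrow> real" where "T j x = (if x \<le> 2 ^ j then x else 0)" for j x
  define E :: "nat \<Rightarrow> real \<Rightarrow> real" where "E j x = (if x \<le> 2 ^ j then 0 else 1)" for j x
  have [measurable]: "T j \<in> borel_measurable borel" "E j \<in> borel_measurable borel" for j
    unfolding T_def E_def by measurable
  define \<mu> where "\<mu> j = expectation (\<lambda>\<omega>. T j (X 0 \<omega>))" for j
  have T_bound: "\<bar>T j (X k \<omega>)\<bar> \<le> 2 ^ j" for j k \<omega>
    using nn[of k \<omega>] by (simp add: T_def)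
  have T_int: "integrable M (\<lambda>\<omega>. T j (X k \<omega>))" for j k
    by (rule integrable_const_bound[of _ "2 ^ j"]) (auto simp: T_bound)
  have T2_int: "integrable M (\<lambda>\<omega>. (T j (X k \<omega>))\<^sup>2)" for j k
  proof (rule integrable_const_bound[of _ "(2 ^ j)\<^sup>2"])
    show "AE \<omega> in M. norm ((T j (X k \<omega>))\<^sup>2) \<le> (2 ^ j)\<^sup>2"
      using power_mono[OF T_bound abs_ge_zero, of j k _ 2] by (intro AE_I2) simp
  qed simp
  have E_int: "integrable M (\<lambda>\<omega>. E j (X k \<omega>))" for j k
    by (rule integrable_const_bound[of _ 1]) (auto simp: E_def)
  have \<mu>_eq: "expectation (\<lambda>\<omega>. T j (X k \<omega>)) = \<mu> j" for j k
    unfolding \<mu>_def by (rule identically_distributed_expectation(1)[OF _ _ _ ident]) auto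
  have \<mu>_le: "\<mu> j \<le> expectation (X 0)" for j
    unfolding \<mu>_def using nn int T_int by (intro integral_mono) (auto simp: T_def)

  define D where "D j k \<omega> = T j (X k \<omega>) - \<mu> j" for j k \<omega>
  have [measurable]: "D j k \<in> borel_measurable M" for j k
    unfolding D_def by measurable
  have D_int: "integrable M (D j k)" for j k
    unfolding D_def using T_int by auto
  have D_bound: "\<bar>D j k \<omega>\<bar> \<le> 2 ^ j + \<bar>\<mu> j\<bar>" for j k \<omega>
    using T_bound[of j k \<omega>] unfolding D_def by linarith
  have DD_int: "integrable M (\<lambda>\<omega>. D i j \<omega> * D i k \<omega>)" for i j k
    by (rule integrable_const_bound[of _ "(2 ^ i + \<bar>\<mu> i\<bar>) * (2 ^ i + \<bar>\<mu> i\<bar>)"])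
       (auto simp: abs_mult intro!: AE_I2 mult_mono D_bound)
  have D_mean: "expectation (D j k) = 0" for j k
    unfolding D_def using T_int[of j k] by (simp add: \<mu>_eq prob_space)
  have D_uncor: "expectation (\<lambda>\<omega>. D i j \<omega> * D i k \<omega>) = 0" if "j < k" for i j k
  proof -
    have "indep_var borel ((\<lambda>x. T i x - \<mu> i) \<circ> X j) borel ((\<lambda>x. T i x - \<mu> i) \<circ> X k)"
      by (rule indep_var_compose[OF indep[OF that]]) auto
    then have "indep_var borel (D i j) borel (D i k)"
      by (simp add: D_def[abs_def] comp_def)
    then have "expectation (\<lambda>\<omega>. D i j \<omega> * D i k \<omega>) = expectation (D i j) * expectation (D i k)"
      by (rule indep_var_lebesgue_integral[OF _ D_int D_int])
    then show ?thesis by (simp add: D_mean)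
  qed
  have D_second: "expectation (\<lambda>\<omega>. (D j k \<omega>)\<^sup>2) \<le> expectation (\<lambda>\<omega>. (T j (X 0 \<omega>))\<^sup>2)" for j k
  proof -
    have "expectation (\<lambda>\<omega>. (D j k \<omega>)\<^sup>2) = variance (\<lambda>\<omega>. T j (X k \<omega>))"
      by (simp add: D_def \<mu>_eq)
    also have "\<dots> \<le> expectation (\<lambda>\<omega>. (T j (X k \<omega>))\<^sup>2)"
      using variance_eq[OF T_int T2_int, of j k] by simp
    also have "\<dots> = expectation (\<lambda>\<omega>. (T j (X 0 \<omega>))\<^sup>2)"
      by (rule identically_distributed_expectation(1)[OF _ _ _ ident, where g="\<lambda>x. (T j x)\<^sup>2"]) auto
    finally show ?thesis .
  qed
  note mom = second_moment_sum_uncorrelated[of "D i" for i, OF DD_int D_uncor]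

  define f where "f j \<omega> = ((\<Sum>k<2 ^ j. D j k \<omega>) / 2 ^ j)\<^sup>2" for j \<omega>
  have "AE \<omega> in M. (\<lambda>j. f j \<omega>) \<longlonglongrightarrow> 0"
  proof (rule AE_tendsto_zero_if_expectations_summable[where B="2 * expectation (X 0)"])
    show "integrable M (f j)" for j
      unfolding f_def power_divide by (intro integrable_divide mom(1))
    show "0 \<le> f j \<omega>" for j \<omega> by (simp add: f_def)
    fix n
    have "expectation (f j) \<le> expectation (\<lambda>\<omega>. (T j (X 0 \<omega>))\<^sup>2 / 2 ^ j)" for j
    proof -
      have "expectation (f j) = (\<Sum>k<2 ^ j. expectation (\<lambda>\<omega>. (D j k \<omega>)\<^sup>2)) / (2 ^ j)\<^sup>2"
        unfolding f_def power_divide using mom(2)[of j "2 ^ j"] by simp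
      also have "\<dots> \<le> (\<Sum>k<(2::nat) ^ j. expectation (\<lambda>\<omega>. (T j (X 0 \<omega>))\<^sup>2)) / (2 ^ j)\<^sup>2"
        by (intro divide_right_mono sum_mono D_second) auto
      also have "\<dots> = expectation (\<lambda>\<omega>. (T j (X 0 \<omega>))\<^sup>2) / 2 ^ j"
        by (simp add: power2_eq_square)
      finally show ?thesis by simp
    qed
    then have "(\<Sum>j<n. expectation (f j)) \<le> (\<Sum>j<n. expectation (\<lambda>\<omega>. (T j (X 0 \<omega>))\<^sup>2 / 2 ^ j))"
      by (intro sum_mono)
    also have "\<dots> = expectation (\<lambda>\<omega>. \<Sum>j<n. (T j (X 0 \<omega>))\<^sup>2 / 2 ^ j)"
      using T2_int by (intro Bochner_Integration.integral_sum[symmetric]) auto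
    also have "\<dots> \<le> expectation (\<lambda>\<omega>. 2 * X 0 \<omega>)"
    proof (rule integral_mono)
      show "(\<Sum>j<n. (T j (X 0 \<omega>))\<^sup>2 / 2 ^ j) \<le> 2 * X 0 \<omega>" for \<omega>
        unfolding T_def by (rule dyadic_truncated_square_sum_le[OF nn])
    qed (use T2_int int in auto)
    finally show "(\<Sum>j<n. expectation (f j)) \<le> 2 * expectation (X 0)" by simp
  qed
  moreover
  \<comment> \<open>\<open>g j\<close> counts the terms that the truncation changes; it is an integer, so \<open>g j < 1\<close> means none.\<close>
  define g where "g j \<omega> = (\<Sum>k<(2::nat) ^ j. E j (X k \<omega>))" for j \<omega>
  have "AE \<omega> in M. (\<lambda>j. g j \<omega>) \<longlonglongrightarrow> 0"
  proof (rule AE_tendsto_zero_if_expectations_summable[where B="2 * expectation (X 0)"])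
    show "integrable M (g j)" for j
      unfolding g_def using E_int by auto
    show "0 \<le> g j \<omega>" for j \<omega> by (auto simp: g_def E_def intro!: sum_nonneg)
    fix n
    have "expectation (g j) = expectation (\<lambda>\<omega>. 2 ^ j * E j (X 0 \<omega>))" for j
    proof -
      have "expectation (g j) = (\<Sum>k<2 ^ j. expectation (\<lambda>\<omega>. E j (X k \<omega>)))"
        unfolding g_def using E_int by (simp add: Bochner_Integration.integral_sum)
      also have "\<dots> = (\<Sum>k<(2::nat) ^ j. expectation (\<lambda>\<omega>. E j (X 0 \<omega>)))"
        by (intro sum.cong refl identically_distributed_expectation(1)[OF _ _ _ ident]) auto
      finally show ?thesis by simp
    qed
    then have "(\<Sum>j<n. expectation (g j)) = expectation (\<lambda>\<omega>. \<Sum>j<n. 2 ^ j * E j (X 0 \<omega>))"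
      using E_int by (simp add: Bochner_Integration.integral_sum)
    also have "\<dots> \<le> expectation (\<lambda>\<omega>. 2 * X 0 \<omega>)"
    proof (rule integral_mono)
      show "(\<Sum>j<n. 2 ^ j * E j (X 0 \<omega>)) \<le> 2 * X 0 \<omega>" for \<omega>
      proof -
        have "2 ^ j * E j x = (if x \<le> 2 ^ j then 0 else 2 ^ j)" for j x
          by (simp add: E_def)
        then show ?thesis
          using dyadic_exceedance_sum_le[OF nn[of 0 \<omega>], of n] by simp
      qed
    qed (use E_int int in auto)
    finally show "(\<Sum>j<n. expectation (g j)) \<le> 2 * expectation (X 0)" by simp
  qed
  ultimately show ?thesis
  proof eventually_elim
    case (elim \<omega>)
    define d where "d = c - expectation (X 0)"
    have d: "d > 0" using c by (simp add: d_def)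
    have "eventually (\<lambda>j. f j \<omega> < d\<^sup>2) sequentially" "eventually (\<lambda>j. g j \<omega> < 1) sequentially"
      using order_tendstoD(2)[OF elim(1), of "d\<^sup>2"] order_tendstoD(2)[OF elim(2), of 1] d by auto
    then have "eventually (\<lambda>j. (\<Sum>k<2 ^ j. X k \<omega>) \<le> c * 2 ^ j) sequentially"
    proof eventually_elim
      case (elim j)
      have "X k \<omega> \<le> 2 ^ j" if "k < 2 ^ j" for k
      proof (rule ccontr)
        assume "\<not> ?thesis"
        then have "1 = E j (X k \<omega>)" by (simp add: E_def)
        also have "\<dots> \<le> g j \<omega>"
          unfolding g_def using that by (intro member_le_sum) (auto simp: E_def)
        finally show False using elim(2) by simp
      qed
      then have "(\<Sum>k<2 ^ j. X k \<omega>) = (\<Sum>k<2 ^ j. D j k \<omega> + \<mu> j)"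
        by (intro sum.cong) (auto simp: D_def T_def)
      also have "\<dots> = (\<Sum>k<2 ^ j. D j k \<omega>) + \<mu> j * 2 ^ j"
        by (simp add: sum.distrib)
      also have "(\<Sum>k<2 ^ j. D j k \<omega>) / 2 ^ j < d"
        using elim(1) d unfolding f_def by (rule_tac power2_less_imp_less) auto
      then have "(\<Sum>k<2 ^ j. D j k \<omega>) \<le> d * 2 ^ j"
        by (simp add: field_simps)
      also have "\<mu> j * 2 ^ j \<le> expectation (X 0) * 2 ^ j"
        by (intro mult_right_mono \<mu>_le) simp
      finally show ?case by (simp add: d_def algebra_simps)
    qed
    then obtain j0 where j0: "\<And>j. j \<ge> j0 \<Longrightarrow> (\<Sum>k<2 ^ j. X k \<omega>) \<le> c * 2 ^ j"
      by (auto simp: eventually_sequentially)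
    have c0: "c \<ge> 0"
      using c Bochner_Integration.integral_nonneg[of M "X 0", OF nn] by linarith
    have "(\<Sum>k<n. X k \<omega>) \<le> 2 * c * real n" if n: "n > 2 ^ j0" "n \<ge> 2" for n
    proof -
      \<comment> \<open>Filling up to the next power of two costs the factor two in the bound.\<close>
      obtain i where i: "2 ^ i < n" "n \<le> 2 ^ (i + 1)"
        using ex_power_ivl2[of 2 n] n by auto
      have "(2::nat) ^ j0 < 2 ^ (i + 1)" using n i by linarith
      then have "j0 < i + 1" by (rule power_less_imp_less_exp[rotated]) simp
      then have "j0 \<le> i + 1" by simp
      have "(\<Sum>k<n. X k \<omega>) \<le> (\<Sum>k<2 ^ (i + 1). X k \<omega>)"
        using i by (intro sum_mono2) (auto simp: nn)
      also have "\<dots> \<le> c * 2 ^ (i + 1)" by (rule j0) fact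
      also have "\<dots> \<le> c * (2 * real n)"
      proof -
        have "real (2 ^ i) \<le> real n" using i by (intro of_nat_mono) simp
        then show ?thesis using c0 by (intro mult_left_mono) auto
      qed
      finally show ?thesis by simp
    qed
    then show ?case
      by (intro eventually_sequentiallyI[of "2 ^ j0 + 2"]) auto
  qed
qed

end

section \<open>Sampled strong law\<close>

context prob_space
begin

lemma vimage_algebra_compose_subset:
  assumes Z: "Z \<in> measurable M U" and h: "h \<in> measurable U U'"
  shows "sets (vimage_algebra (space M) (\<lambda>\<omega>. h (Z \<omega>)) U') \<subseteq> sets (vimage_algebra (space M) Z U)"
proof -
  have "(\<lambda>\<omega>. h (Z \<omega>)) \<in> measurable (vimage_algebra (space M) Z U) U'"
    by (rule measurable_compose[OF measurable_vimage_algebra1 h])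
       (use Z in \<open>auto simp: measurable_def\<close>)
  then show ?thesis
    by (subst sets_vimage_algebra)
       (auto intro!: sets.sigma_sets_subset[of _ "vimage_algebra (space M) Z U", simplified] dest: measurable_sets)
qed

lemma indep_rvs_compose:
  assumes ind: "indep_rvs M S X T Y"
    and X: "X \<in> measurable M S" and Y: "Y \<in> measurable M T"
    and f: "f \<in> measurable S S'" and g: "g \<in> measurable T T'"
  shows "indep_rvs M S' (\<lambda>\<omega>. f (X \<omega>)) T' (\<lambda>\<omega>. g (Y \<omega>))"
  using ind vimage_algebra_compose_subset[OF X f] vimage_algebra_compose_subset[OF Y g]
  unfolding indep_rvs_def indep_set_def
  by (elim indep_sets_mono_sets) (auto split: bool.split)

lemma indep_rvs_imp_indep_var:
  fixes X Y :: "'a \<Rightarrow> real"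
  assumes "indep_rvs M borel X borel Y" "X \<in> borel_measurable M" "Y \<in> borel_measurable M"
  shows "indep_var borel X borel Y"
  using assms unfolding indep_var_eq indep_rvs_def sets_vimage_algebra by blast

text \<open>
  The weight \<open>B k\<close> may depend on the earlier variables, but \<open>X k\<close> is independent of it jointly with
  each of them. Every \<open>X k\<close> is split at a level \<open>m\<close>. The parts below \<open>m\<close> are bounded and, after
  centring and weighting, uncorrelated, because the centred factor of the later term is independent of
  all the other factors. The means of the excesses over \<open>m\<close> are, with the weights dropped, eventually
  at most a multiple of a number that tends to zero as \<open>m\<close> grows.
\<close>

lemma strong_law_predictable_weights:
  fixes X B :: "nat \<Rightarrow> 'a \<Rightarrow> real"
  assumes X [measurable]: "\<And>k. X k \<in> borel_measurable M"
    and B [measurable]: "\<And>k. B k \<in> borel_measurable M"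
    and X_nn: "\<And>k. AE \<omega> in M. 0 \<le> X k \<omega>"
    and B_bound: "\<And>k. AE \<omega> in M. 0 \<le> B k \<omega> \<and> B k \<omega> \<le> 1"
    and ident: "\<And>k. distr M borel (X k) = distr M borel (X 0)"
    and int: "integrable M (X 0)"
    and indep: "\<And>j k. j < k \<Longrightarrow> indep_rvs M borel (\<lambda>\<omega>. (X j \<omega>, B j \<omega>, B k \<omega>)) borel (X k)"
  shows "converges_as_and_L1 M (\<lambda>n \<omega>. (\<Sum>k<n. B k \<omega> * (X k \<omega> - expectation (X 0))) / real n) 0"
proof -
  define \<mu> where "\<mu> = expectation (X 0)"
  define y where "y m = expectation (\<lambda>\<omega>. min (X 0 \<omega>) (real m))" for m :: nat
  define Z where "Z m k \<omega> = max 0 (X k \<omega> - real m)" for m k \<omega>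
  define z where "z m = expectation (Z m 0)" for m
  define D where "D m k \<omega> = B k \<omega> * (min (X k \<omega>) (real m) - y m)" for m k \<omega>
  have [measurable]: "Z m k \<in> borel_measurable M" "D m k \<in> borel_measurable M" for m k
    unfolding Z_def D_def by measurable
  have X_int: "integrable M (X k)" for k
    using identically_distributed_expectation(2)[OF X X _ ident, of "\<lambda>x. x" k] int by simp
  have Z_int: "integrable M (Z m k)" for m k
    unfolding Z_def using X_int by (intro integrable_max) auto
  have Z_mean: "expectation (Z m k) = z m" for m k
    unfolding z_def Z_def
    by (rule identically_distributed_expectation(1)[OF _ _ _ ident, where g="\<lambda>x. max 0 (x - real m)"]) auto
  have Z_nn: "0 \<le> Z m k \<omega>" for m k \<omega> by (simp add: Z_def)
  have z_nn: "0 \<le> z m" for m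
    unfolding z_def by (rule Bochner_Integration.integral_nonneg) (rule Z_nn)
  have min_int: "integrable M (\<lambda>\<omega>. min (X k \<omega>) (real m))" for m k
    using X_int by (intro integrable_min) auto
  have split: "X k \<omega> = min (X k \<omega>) (real m) + Z m k \<omega>" for m k \<omega>
    by (simp add: Z_def)
  have \<mu>_split: "\<mu> = y m + z m" for m
    unfolding \<mu>_def y_def z_def
    using Bochner_Integration.integral_add[OF min_int[of 0 m] Z_int[of m 0]] split[of 0 _ m] by simp
  have y_bound: "0 \<le> y m" "y m \<le> real m" for m
  proof -
    show "0 \<le> y m" unfolding y_def
      using X_nn[of 0] by (intro integral_nonneg_AE) (auto elim!: eventually_mono)
    have "y m \<le> expectation (\<lambda>\<omega>. real m)"
      unfolding y_def using min_int by (intro integral_mono) auto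
    then show "y m \<le> real m" by (simp add: prob_space)
  qed
  have z_lim: "z \<longlonglongrightarrow> 0"
  proof -
    have "(\<lambda>m. expectation (Z m 0)) \<longlonglongrightarrow> expectation (\<lambda>\<omega>. 0)"
    proof (rule integral_dominated_convergence[where w="\<lambda>\<omega>. \<bar>X 0 \<omega>\<bar>"])
      show "AE \<omega> in M. (\<lambda>m. Z m 0 \<omega>) \<longlonglongrightarrow> 0"
      proof (rule AE_I2)
        fix \<omega>
        obtain m0 where m0: "X 0 \<omega> \<le> real m0" using real_arch_simple by blast
        have "eventually (\<lambda>m. Z m 0 \<omega> = 0) sequentially"
          using eventually_ge_at_top[of m0]
          by eventually_elim (use m0 in \<open>auto simp: Z_def\<close>)
        then show "(\<lambda>m. Z m 0 \<omega>) \<longlonglongrightarrow> 0" by (rule tendsto_eventually)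
      qed
    qed (use int in \<open>auto simp: Z_def\<close>)
    then show ?thesis by (simp add: z_def[abs_def])
  qed

  have mean_D: "converges_as_and_L1 M (\<lambda>n \<omega>. (\<Sum>k<n. D m k \<omega>) / real n) 0" for m
  proof (rule strong_law_bounded_uncorrelated)
    have D_bound: "AE \<omega> in M. \<bar>B k \<omega>\<bar> \<le> 1 \<and> \<bar>min (X k \<omega>) (real m) - y m\<bar> \<le> real m" for k
      using X_nn[of k] B_bound[of k] by eventually_elim (use y_bound[of m] in auto)
    show "AE \<omega> in M. \<bar>D m k \<omega>\<bar> \<le> real m" for k
      using D_bound[of k]
      by eventually_elim (use mult_mono[of "\<bar>B k _\<bar>" 1 "\<bar>min (X k _) (real m) - y m\<bar>" "real m"] in \<open>auto simp: D_def abs_mult\<close>)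
    fix j k :: nat assume jk: "j < k"
    let ?F = "\<lambda>\<omega>. B j \<omega> * (min (X j \<omega>) (real m) - y m) * B k \<omega>"
    let ?G = "\<lambda>\<omega>. min (X k \<omega>) (real m) - y m"
    have "indep_rvs M borel (\<lambda>\<omega>. (\<lambda>(x, b, b'). b * (min x (real m) - y m) * b') (X j \<omega>, B j \<omega>, B k \<omega>))
        borel (\<lambda>\<omega>. (\<lambda>x. min x (real m) - y m) (X k \<omega>))"
    proof (rule indep_rvs_compose[OF indep[OF jk]])
      show "(\<lambda>(x, b, b'). b * (min x (real m) - y m) * b') \<in> borel_measurable (borel :: (real \<times> real \<times> real) measure)"
        unfolding borel_prod[symmetric] by measurable
      show "(\<lambda>\<omega>. (X j \<omega>, B j \<omega>, B k \<omega>)) \<in> borel_measurable M"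
        unfolding borel_prod[symmetric] by measurable
    qed auto
    then have ind: "indep_var borel ?F borel ?G"
      by (intro indep_rvs_imp_indep_var) simp_all
    have "integrable M ?F"
    proof (rule integrable_const_bound[of _ "1 * real m * 1"])
      show "AE \<omega> in M. norm (?F \<omega>) \<le> 1 * real m * 1"
        using D_bound[of j] D_bound[of k]
      proof eventually_elim
        case (elim \<omega>)
        have "\<bar>B j \<omega>\<bar> * \<bar>min (X j \<omega>) (real m) - y m\<bar> \<le> 1 * real m"
          by (rule mult_mono) (use elim in auto)
        then have "\<bar>B j \<omega>\<bar> * \<bar>min (X j \<omega>) (real m) - y m\<bar> * \<bar>B k \<omega>\<bar> \<le> 1 * real m * 1"
          by (rule mult_mono) (use elim in auto)
        then show ?case by (simp add: abs_mult)
      qed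
    qed simp
    moreover have "integrable M ?G" using min_int by auto
    ultimately have "expectation (\<lambda>\<omega>. ?F \<omega> * ?G \<omega>) = expectation ?F * expectation ?G"
      by (rule indep_var_lebesgue_integral[OF ind])
    also have "expectation ?G = 0"
    proof -
      have "expectation (\<lambda>\<omega>. min (X k \<omega>) (real m)) = y m"
        unfolding y_def
        by (rule identically_distributed_expectation(1)[OF _ _ _ ident, where g="\<lambda>x. min x (real m)"]) auto
      then show ?thesis using min_int by (simp add: prob_space)
    qed
    finally show "expectation (\<lambda>\<omega>. D m j \<omega> * D m k \<omega>) = 0"
      by (simp add: D_def mult.assoc)
  qed simp

  have Z_indep: "indep_var borel (Z m j) borel (Z m k)" if jk: "j < k" for m j k
  proof -
    have "indep_rvs M borel (\<lambda>\<omega>. (\<lambda>p. max 0 (fst p - real m)) (X j \<omega>, B j \<omega>, B k \<omega>))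
        borel (\<lambda>\<omega>. (\<lambda>x. max 0 (x - real m)) (X k \<omega>))"
    proof (rule indep_rvs_compose[OF indep[OF jk]])
      show "(\<lambda>p. max 0 (fst p - real m)) \<in> borel_measurable (borel :: (real \<times> real \<times> real) measure)"
        unfolding borel_prod[symmetric] by measurable
      show "(\<lambda>\<omega>. (X j \<omega>, B j \<omega>, B k \<omega>)) \<in> borel_measurable M"
        unfolding borel_prod[symmetric] by measurable
    qed auto
    then show ?thesis
      by (intro indep_rvs_imp_indep_var) (simp_all add: Z_def[abs_def])
  qed
  have Z_ident: "distr M borel (Z m k) = distr M borel (Z m 0)" for m k
  proof -
    have "distr M borel (Z m k) = distr (distr M borel (X k)) borel (\<lambda>x. max 0 (x - real m))" for k
      by (subst distr_distr) (auto simp: Z_def[abs_def] comp_def)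
    then show ?thesis by (metis ident)
  qed
  have mean_Z: "AE \<omega> in M. eventually (\<lambda>n. (\<Sum>k<n. Z m k \<omega>) \<le> 2 * (z m + 1 / Suc m) * real n) sequentially" for m
    by (rule nonneg_iid_mean_eventually_le[of "Z m", OF _ Z_nn Z_ident Z_indep Z_int])
       (auto simp: z_def)

  define T where "T n \<omega> = (\<Sum>k<n. B k \<omega> * (X k \<omega> - \<mu>)) / real n" for n \<omega>
  have [measurable]: "T n \<in> borel_measurable M" for n unfolding T_def by measurable
  have B_all: "AE \<omega> in M. \<forall>k. 0 \<le> B k \<omega> \<and> B k \<omega> \<le> 1"
    using B_bound by (simp add: AE_all_countable)
  have T_le: "\<bar>T n \<omega>\<bar> \<le> \<bar>(\<Sum>k<n. D m k \<omega>) / real n\<bar> + (\<Sum>k<n. Z m k \<omega>) / real n + z m"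
    if B: "\<forall>k. 0 \<le> B k \<omega> \<and> B k \<omega> \<le> 1" for n m \<omega>
  proof -
    have "(\<Sum>k<n. B k \<omega> * (X k \<omega> - \<mu>)) = (\<Sum>k<n. D m k \<omega>) + (\<Sum>k<n. B k \<omega> * (Z m k \<omega> - z m))"
      unfolding sum.distrib[symmetric]
    proof (rule sum.cong)
      fix k
      show "B k \<omega> * (X k \<omega> - \<mu>) = D m k \<omega> + B k \<omega> * (Z m k \<omega> - z m)"
        unfolding \<mu>_split[of m] D_def by (subst split[of k \<omega> m]) (simp add: algebra_simps)
    qed simp
    moreover have "\<bar>\<Sum>k<n. B k \<omega> * (Z m k \<omega> - z m)\<bar> \<le> (\<Sum>k<n. Z m k \<omega> + z m)"
    proof (rule order_trans[OF sum_abs sum_mono])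
      fix k
      have "\<bar>B k \<omega> * (Z m k \<omega> - z m)\<bar> \<le> 1 * \<bar>Z m k \<omega> - z m\<bar>"
        unfolding abs_mult using B by (intro mult_right_mono) auto
      also have "\<dots> \<le> Z m k \<omega> + z m" using Z_nn[of m k \<omega>] z_nn[of m] by auto
      finally show "\<bar>B k \<omega> * (Z m k \<omega> - z m)\<bar> \<le> Z m k \<omega> + z m" .
    qed
    ultimately have "\<bar>\<Sum>k<n. B k \<omega> * (X k \<omega> - \<mu>)\<bar> \<le> \<bar>\<Sum>k<n. D m k \<omega>\<bar> + ((\<Sum>k<n. Z m k \<omega>) + real n * z m)"
      by (simp add: sum.distrib)
    then have "\<bar>\<Sum>k<n. B k \<omega> * (X k \<omega> - \<mu>)\<bar> / real n
        \<le> (\<bar>\<Sum>k<n. D m k \<omega>\<bar> + ((\<Sum>k<n. Z m k \<omega>) + real n * z m)) / real n"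
      by (intro divide_right_mono) auto
    also have "\<dots> \<le> \<bar>\<Sum>k<n. D m k \<omega>\<bar> / real n + (\<Sum>k<n. Z m k \<omega>) / real n + z m"
      using z_nn[of m] by (cases "n = 0") (auto simp: add_divide_distrib)
    finally show ?thesis by (simp add: T_def abs_divide)
  qed

  have T_int: "integrable M (T n)" for n
  proof -
    have "integrable M (\<lambda>\<omega>. B k \<omega> * (X k \<omega> - \<mu>))" for k
    proof (rule Bochner_Integration.integrable_bound)
      show "integrable M (\<lambda>\<omega>. X k \<omega> - \<mu>)" using X_int by auto
      show "AE \<omega> in M. norm (B k \<omega> * (X k \<omega> - \<mu>)) \<le> norm (X k \<omega> - \<mu>)"
        using B_bound[of k] by eventually_elim (auto simp: abs_mult intro!: mult_left_le_one_le)
    qed simp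
    then show ?thesis unfolding T_def[abs_def] by (intro integrable_divide Bochner_Integration.integrable_sum)
  qed

  have small: "\<exists>m. 3 * z m + 2 / Suc m < e" if e: "e > 0" for e :: real
  proof -
    have "(\<lambda>m. 3 * z m + 2 * inverse (real (Suc m))) \<longlonglongrightarrow> 3 * 0 + 2 * 0"
      by (intro tendsto_intros z_lim LIMSEQ_inverse_real_of_nat)
    then have "eventually (\<lambda>m. 3 * z m + 2 * inverse (real (Suc m)) < e) sequentially"
      using e by (intro order_tendstoD(2)) auto
    then show ?thesis by (auto simp: eventually_sequentially divide_inverse)
  qed

  have "AE \<omega> in M. \<forall>m. (\<lambda>n. (\<Sum>k<n. D m k \<omega>) / real n) \<longlonglongrightarrow> 0"
    using mean_D by (simp add: AE_all_countable converges_as_and_L1_def)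
  moreover have "AE \<omega> in M. \<forall>m. eventually (\<lambda>n. (\<Sum>k<n. Z m k \<omega>) \<le> 2 * (z m + 1 / Suc m) * real n) sequentially"
    using mean_Z by (simp only: AE_all_countable) simp
  ultimately have T_as: "AE \<omega> in M. (\<lambda>n. T n \<omega>) \<longlonglongrightarrow> 0"
    using B_all
  proof eventually_elim
    case (elim \<omega>)
    show ?case
    proof (rule tendstoI)
      fix e :: real assume e: "e > 0"
      obtain m where m: "3 * z m + 2 / Suc m < e" using small[OF e] by blast
      define d where "d = e - (3 * z m + 2 / Suc m)"
      have "eventually (\<lambda>n. dist ((\<Sum>k<n. D m k \<omega>) / real n) 0 < d) sequentially"
        using elim(1) m by (intro tendstoD) (auto simp: d_def)
      moreover have "eventually (\<lambda>n. (\<Sum>k<n. Z m k \<omega>) \<le> 2 * (z m + 1 / Suc m) * real n) sequentially"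
        using elim(2) by blast
      ultimately show "eventually (\<lambda>n. dist (T n \<omega>) 0 < e) sequentially"
        using eventually_gt_at_top[of 0]
      proof eventually_elim
        case (elim n)
        have "(\<Sum>k<n. Z m k \<omega>) / real n \<le> 2 * (z m + 1 / Suc m)"
          using elim(2,3) by (simp add: pos_divide_le_eq)
        then have "\<bar>T n \<omega>\<bar> < d + 2 * (z m + 1 / Suc m) + z m"
          using T_le[of \<omega> n m] \<open>\<forall>k. 0 \<le> B k \<omega> \<and> B k \<omega> \<le> 1\<close> elim(1) by simp
        then show ?case by (simp add: d_def)
      qed
    qed
  qed

  have T_L1: "(\<lambda>n. expectation (\<lambda>\<omega>. \<bar>T n \<omega>\<bar>)) \<longlonglongrightarrow> 0"
  proof (rule tendstoI)
    fix e :: real assume e: "e > 0"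
    obtain m where "3 * z m + 2 / Suc m < e" using small[OF e] by blast
    moreover have "0 \<le> 2 / real (Suc m)" by simp
    ultimately have m: "2 * z m < e" using z_nn[of m] by linarith
    have "(\<lambda>n. expectation (\<lambda>\<omega>. \<bar>(\<Sum>k<n. D m k \<omega>) / real n\<bar>)) \<longlonglongrightarrow> 0"
      using mean_D[of m] by (simp add: converges_as_and_L1_def)
    then have "eventually (\<lambda>n. expectation (\<lambda>\<omega>. \<bar>(\<Sum>k<n. D m k \<omega>) / real n\<bar>) < e - 2 * z m) sequentially"
      using m by (intro order_tendstoD(2)) auto
    then show "eventually (\<lambda>n. dist (expectation (\<lambda>\<omega>. \<bar>T n \<omega>\<bar>)) 0 < e) sequentially"
    proof eventually_elim
      case (elim n)
      have D_int: "integrable M (\<lambda>\<omega>. (\<Sum>k<n. D m k \<omega>) / real n)"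
        using mean_D[of m] by (simp add: converges_as_and_L1_def)
      have ZS_int: "integrable M (\<lambda>\<omega>. (\<Sum>k<n. Z m k \<omega>) / real n)"
        using Z_int by auto
      have "expectation (\<lambda>\<omega>. \<bar>T n \<omega>\<bar>)
          \<le> expectation (\<lambda>\<omega>. \<bar>(\<Sum>k<n. D m k \<omega>) / real n\<bar> + (\<Sum>k<n. Z m k \<omega>) / real n + z m)"
      proof (rule integral_mono_AE)
        show "AE \<omega> in M. \<bar>T n \<omega>\<bar> \<le> \<bar>(\<Sum>k<n. D m k \<omega>) / real n\<bar> + (\<Sum>k<n. Z m k \<omega>) / real n + z m"
          using B_all by eventually_elim (rule T_le)
        show "integrable M (\<lambda>\<omega>. \<bar>(\<Sum>k<n. D m k \<omega>) / real n\<bar> + (\<Sum>k<n. Z m k \<omega>) / real n + z m)"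
          using D_int ZS_int by (intro Bochner_Integration.integrable_add integrable_abs) auto
      qed (use T_int in auto)
      also have "\<dots> = expectation (\<lambda>\<omega>. \<bar>(\<Sum>k<n. D m k \<omega>) / real n\<bar>)
          + expectation (\<lambda>\<omega>. (\<Sum>k<n. Z m k \<omega>) / real n) + z m"
        using integrable_abs[OF D_int] ZS_int
        by (subst Bochner_Integration.integral_add, simp, simp)+ (simp add: prob_space)
      also have "expectation (\<lambda>\<omega>. (\<Sum>k<n. Z m k \<omega>) / real n) \<le> z m"
        using Z_int z_nn[of m] by (simp add: Bochner_Integration.integral_sum Z_mean)
      finally have "expectation (\<lambda>\<omega>. \<bar>T n \<omega>\<bar>) < e" using elim by linarith
      then show ?case by (simp add: integral_nonneg_AE)
    qed
  qed
  have "converges_as_and_L1 M T 0"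
    using T_as T_L1 T_int by (simp add: converges_as_and_L1_def)
  then show ?thesis by (simp add: T_def[abs_def] \<mu>_def)
qed

end

section \<open>The urn\<close>

lemma bounded_linear_vec_mult: "bounded_linear (\<lambda>x. x v* (A :: real^'k^'k))"
  unfolding transpose_matrix_vector[symmetric] by (rule matrix_vector_mul_bounded_linear)

lemma measurable_vec_nth [measurable (raw)]:
  fixes f :: "'a \<Rightarrow> 'b::real_normed_vector^'n"
  assumes "f \<in> borel_measurable M"
  shows "(\<lambda>\<omega>. f \<omega> $ i) \<in> borel_measurable M"
  by (rule measurable_compose[OF assms borel_measurable_continuous_onI]) (intro continuous_intros)

lemma measurable_vec_mult [measurable (raw)]:
  fixes x :: "'a \<Rightarrow> real^'k" and A :: "'a \<Rightarrow> real^'k^'k"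
  assumes "x \<in> borel_measurable M" "A \<in> borel_measurable M"
  shows "(\<lambda>\<omega>. x \<omega> v* A \<omega>) \<in> borel_measurable M"
proof (rule borel_measurable_continuous_Pair[OF assms])
  show "continuous_on UNIV (\<lambda>z. (fst z :: real^'k) v* (snd z :: real^'k^'k))"
    unfolding vector_matrix_mult_def by (intro continuous_intros)
qed

lemma (in prob_space) converges_as_and_L1_vec:
  fixes X :: "nat \<Rightarrow> 'a \<Rightarrow> real^'k"
  assumes "\<And>i. converges_as_and_L1 M (\<lambda>n \<omega>. X n \<omega> $ i) (c $ i)"
  shows "converges_as_and_L1 M X c"
proof -
  have expand: "(\<Sum>i\<in>UNIV. x $ i *\<^sub>R axis i 1) = x" for x :: "real^'k"
    using basis_expansion[of x] by (simp add: scalar_mult_eq_scaleR)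
  have "converges_as_and_L1 M (\<lambda>n \<omega>. \<Sum>i\<in>UNIV. X n \<omega> $ i *\<^sub>R (axis i 1 :: real^'k))
      (\<Sum>i\<in>UNIV. c $ i *\<^sub>R axis i 1)"
    by (intro converges_as_and_L1_sum converges_as_and_L1_linear[OF bounded_linear_scaleR_left] assms) simp
  then show ?thesis by (simp only: expand)
qed

lemma max_row_sum_ge_entry: "\<bar>A $ i $ j\<bar> \<le> max_row_sum A"
proof -
  have "\<bar>A $ i $ j\<bar> \<le> (\<Sum>j\<in>UNIV. \<bar>A $ i $ j\<bar>)"
    by (rule member_le_sum) auto
  also have "\<dots> \<le> max_row_sum A"
    unfolding max_row_sum_def by (rule Max_ge) auto
  finally show ?thesis .
qed

locale iid_urn = urn_model M C R chi
  for M :: "'a measure" and C :: "nat \<Rightarrow> 'a \<Rightarrow> real^'k"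
    and R :: "nat \<Rightarrow> 'a \<Rightarrow> real^'k^'k" and chi :: "nat \<Rightarrow> 'a \<Rightarrow> real^'k" +
  fixes H :: "real^'k^'k"
  assumes C0_nonzero: "AE \<omega> in M. C 0 \<omega> \<noteq> 0"
    and C0_nonneg: "AE \<omega> in M. \<forall>i. 0 \<le> C 0 \<omega> $ i"
    and C0_mean: "integrable M (C 0)"
    and R_ident: "\<And>n. n \<ge> 1 \<Longrightarrow> distr M borel (R n) = distr M borel (R 1)"
    and H_def: "H = (\<integral>\<omega>. R 1 \<omega> \<partial>M)"
    and H_irreducible: "irreducible_matrix H"
    and R_mean: "integrable M (\<lambda>\<omega>. max_row_sum (R 1 \<omega>))"
    and draw: "\<And>n i. n \<ge> 1 \<Longrightarrow>
      AE \<omega> in M.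
        real_cond_exp M
          (vimage_algebra (space M) (urn_history C R chi (n - 1) (n - 1)) (history_space (n - 1) (n - 1)))
          (indicator {\<omega> \<in> space M. chi n \<omega> = axis i 1}) \<omega>
        = C (n - 1) \<omega> $ i / total_content C (n - 1) \<omega>"
    and future_indep: "\<And>n. n \<ge> 1 \<Longrightarrow>
      indep_rvs M
        (history_space (n - 1) n) (urn_history C R chi (n - 1) n)
        (PiM {n..} (\<lambda>_. borel)) (\<lambda>\<omega>. \<lambda>m\<in>{n..}. R m \<omega>)"
begin

abbreviation S :: "nat \<Rightarrow> 'a \<Rightarrow> real" where
  "S \<equiv> total_content C"

text \<open>The arguments of \<open>history_space\<close> leave the type of colours open; here it is that of the urn.\<close>

abbreviation past_space :: "nat \<Rightarrow> nat \<Rightarrow> ((real^'k) \<times> (nat \<Rightarrow> real^'k^'k) \<times> (nat \<Rightarrow> real^'k)) measure" where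
  "past_space \<equiv> history_space"

definition composition :: "nat \<Rightarrow> 'a \<Rightarrow> real^'k" where
  "composition n \<omega> = C n \<omega> /\<^sub>R S n \<omega>"

lemma measurable_R_Suc [measurable]: "R (Suc n) \<in> borel_measurable M"
  by (rule measurable_R) simp

lemma measurable_chi_Suc [measurable]: "chi (Suc n) \<in> borel_measurable M"
  by (rule measurable_chi) simp

lemma C_eq_sum:
  assumes "\<omega> \<in> space M"
  shows "C n \<omega> = C 0 \<omega> + (\<Sum>k<n. chi (Suc k) \<omega> v* R (Suc k) \<omega>)"
  by (induction n) (use C_step[OF _ assms, of "Suc n" for n] in \<open>simp_all add: add.assoc\<close>)

lemma measurable_C [measurable]: "C n \<in> borel_measurable M"
proof -
  note measurable_C0 [measurable]
  have "(\<lambda>\<omega>. C 0 \<omega> + (\<Sum>k<n. chi (Suc k) \<omega> v* R (Suc k) \<omega>)) \<in> borel_measurable M"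
    by measurable
  then show ?thesis
    by (subst measurable_cong[OF C_eq_sum])
qed

lemma measurable_S [measurable]: "S n \<in> borel_measurable M"
  unfolding total_content_def[abs_def] by measurable

lemma measurable_composition [measurable]: "composition n \<in> borel_measurable M"
  unfolding composition_def[abs_def] by measurable

lemma chi_bounds:
  "AE \<omega> in M. \<forall>n i. 0 \<le> chi (Suc n) \<omega> $ i \<and> chi (Suc n) \<omega> $ i \<le> 1"
proof -
  have "AE \<omega> in M. \<forall>n. \<exists>i. chi (Suc n) \<omega> = axis i 1"
    using chi_unit by (simp add: AE_all_countable)
  then show ?thesis
  proof eventually_elim
    case (elim \<omega>)
    show ?case
    proof (intro allI)
      fix n i
      obtain j where "chi (Suc n) \<omega> = axis j 1" using elim by blast
      then show "0 \<le> chi (Suc n) \<omega> $ i \<and> chi (Suc n) \<omega> $ i \<le> 1" by (simp add: axis_def)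
    qed
  qed
qed

lemma content_pos_nonneg:
  "AE \<omega> in M. \<forall>n. 0 < S n \<omega> \<and> (\<forall>i. 0 \<le> C n \<omega> $ i)"
proof -
  have "AE \<omega> in M. \<forall>n i j. 0 \<le> R (Suc n) \<omega> $ i $ j"
    using R_nonneg by (simp add: AE_all_countable)
  then show ?thesis
    using chi_bounds C0_nonzero C0_nonneg AE_space
  proof eventually_elim
    case (elim \<omega>)
    have added: "0 \<le> (chi (Suc k) \<omega> v* R (Suc k) \<omega>) $ j" for k j
      unfolding vec_mult_nth using elim(1,2) by (intro sum_nonneg mult_nonneg_nonneg) auto
    have mono: "C 0 \<omega> $ i \<le> C n \<omega> $ i" for n i
      using elim(5) by (subst C_eq_sum) (auto intro!: sum_nonneg added)
    obtain i where "0 < C 0 \<omega> $ i"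
      using elim(3,4) by (metis order_less_le vec_eq_iff zero_index)
    then have "0 < S n \<omega>" for n
      unfolding total_content_def using mono elim(4)
      by (intro sum_pos2[of UNIV i]) (auto intro: order_trans less_le_trans)
    then show ?case using mono elim(4) by (meson order_trans)
  qed
qed

lemma composition_bounds:
  "AE \<omega> in M. \<forall>n. (\<forall>i. 0 \<le> composition n \<omega> $ i \<and> composition n \<omega> $ i \<le> 1) \<and> norm (composition n \<omega>) \<le> 1"
  using content_pos_nonneg
proof eventually_elim
  case (elim \<omega>)
  have nn: "0 \<le> composition n \<omega> $ i" for n i
    using elim by (simp add: composition_def less_imp_le)
  have sum1: "(\<Sum>i\<in>UNIV. composition n \<omega> $ i) = 1" for n
  proof -
    have "(\<Sum>i\<in>UNIV. composition n \<omega> $ i) = inverse (S n \<omega>) * S n \<omega>"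
      unfolding composition_def total_content_def by (simp add: sum_distrib_left)
    also have "\<dots> = 1" using elim by (metis less_irrefl left_inverse)
    finally show ?thesis .
  qed
  have "composition n \<omega> $ i \<le> (\<Sum>i\<in>UNIV. composition n \<omega> $ i)" for n i
    by (rule member_le_sum) (auto simp: nn)
  moreover have "norm (composition n \<omega>) \<le> (\<Sum>i\<in>UNIV. \<bar>composition n \<omega> $ i\<bar>)" for n
    by (rule norm_le_l1_cart)
  ultimately show ?case using nn sum1 by simp
qed

lemma R_entry_integrable: "integrable M (\<lambda>\<omega>. R 1 \<omega> $ i $ j)"
  by (rule Bochner_Integration.integrable_bound[OF R_mean])
     (use measurable_R_Suc[of 0] in \<open>auto intro!: AE_I2 order_trans[OF max_row_sum_ge_entry]\<close>)

lemma H_entry: "H $ i $ j = expectation (\<lambda>\<omega>. R 1 \<omega> $ i $ j)"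
proof -
  have R1: "R 1 \<in> borel_measurable M" by (rule measurable_R) simp
  have "integrable M (R 1)"
  proof (rule Bochner_Integration.integrable_bound[OF _ R1])
    show "integrable M (\<lambda>\<omega>. \<Sum>i\<in>UNIV. \<Sum>j\<in>UNIV. \<bar>R 1 \<omega> $ i $ j\<bar>)"
      using R_entry_integrable by (intro Bochner_Integration.integrable_sum integrable_abs)
    have "norm (R 1 \<omega>) \<le> (\<Sum>i\<in>UNIV. \<Sum>j\<in>UNIV. \<bar>R 1 \<omega> $ i $ j\<bar>)" for \<omega>
    proof -
      have "norm (R 1 \<omega>) \<le> (\<Sum>i\<in>UNIV. norm (R 1 \<omega> $ i))"
        unfolding norm_vec_def by (rule L2_set_le_sum) simp
      also have "\<dots> \<le> (\<Sum>i\<in>UNIV. \<Sum>j\<in>UNIV. \<bar>R 1 \<omega> $ i $ j\<bar>)"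
        by (intro sum_mono norm_le_l1_cart)
      finally show ?thesis .
    qed
    then show "AE \<omega> in M. norm (R 1 \<omega>) \<le> norm (\<Sum>i\<in>UNIV. \<Sum>j\<in>UNIV. \<bar>R 1 \<omega> $ i $ j\<bar>)"
      by (intro AE_I2) (smt (verit) real_norm_def)
  qed
  moreover have "bounded_linear (\<lambda>A :: real^'k^'k. A $ i $ j)"
    by (rule bounded_linear_compose[OF bounded_linear_vec_nth bounded_linear_vec_nth])
  ultimately show ?thesis
    unfolding H_def by (rule integral_bounded_linear[symmetric, rotated])
qed

lemma measurable_urn_history:
  "urn_history C R chi a b \<in> measurable M (past_space a b)"
proof -
  note measurable_C0 [measurable]
  have [measurable]: "(\<lambda>\<omega>. \<lambda>m\<in>{1..a}. R m \<omega>) \<in> measurable M (PiM {1..a} (\<lambda>_. borel))"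
    by (rule measurable_restrict) (simp add: measurable_R)
  have [measurable]: "(\<lambda>\<omega>. \<lambda>m\<in>{1..b}. chi m \<omega>) \<in> measurable M (PiM {1..b} (\<lambda>_. borel))"
    by (rule measurable_restrict) (simp add: measurable_chi)
  show ?thesis
    unfolding urn_history_def[abs_def] history_space_def by measurable
qed

lemma measurable_history_R:
  assumes "m \<in> {1..a}"
  shows "(\<lambda>h. fst (snd h) m) \<in> borel_measurable (past_space a b)"
  unfolding history_space_def
  by (rule measurable_compose[OF _ measurable_component_singleton[OF assms]]) measurable

lemma measurable_history_chi:
  assumes "m \<in> {1..b}"
  shows "(\<lambda>h. snd (snd h) m) \<in> borel_measurable (past_space a b)"
  unfolding history_space_def
  by (rule measurable_compose[OF _ measurable_component_singleton[OF assms]]) measurable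

text \<open>
  For the entries in row \<open>i\<close> the indicator of drawing colour \<open>i\<close> is a weight that is fixed before
  the replacement matrix is revealed.
\<close>

lemma replacement_error_converges:
  "converges_as_and_L1 M (\<lambda>n \<omega>. (\<Sum>k<n. chi (Suc k) \<omega> v* (R (Suc k) \<omega> - H)) /\<^sub>R real n) 0"
proof (rule converges_as_and_L1_vec)
  fix j
  have entry: "converges_as_and_L1 M (\<lambda>n \<omega>. (\<Sum>k<n. chi (Suc k) \<omega> $ i * (R (Suc k) \<omega> $ i $ j - H $ i $ j)) / real n) 0" for i
  proof -
    have "converges_as_and_L1 M (\<lambda>n \<omega>. (\<Sum>k<n. chi (Suc k) \<omega> $ i
        * (R (Suc k) \<omega> $ i $ j - expectation (\<lambda>\<omega>. R (Suc 0) \<omega> $ i $ j))) / real n) 0"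
    proof (rule strong_law_predictable_weights[where X="\<lambda>k \<omega>. R (Suc k) \<omega> $ i $ j" and B="\<lambda>k \<omega>. chi (Suc k) \<omega> $ i"])
      show "AE \<omega> in M. 0 \<le> R (Suc k) \<omega> $ i $ j" for k
        using R_nonneg[of "Suc k"] by (auto elim!: eventually_mono)
      show "AE \<omega> in M. 0 \<le> chi (Suc k) \<omega> $ i \<and> chi (Suc k) \<omega> $ i \<le> 1" for k
        using chi_bounds by (auto elim!: eventually_mono)
      have "distr M borel (\<lambda>\<omega>. R (Suc k) \<omega> $ i $ j) = distr (distr M borel (R (Suc k))) borel (\<lambda>A. A $ i $ j)" for k
        by (subst distr_distr) (auto simp: comp_def)
      then show "distr M borel (\<lambda>\<omega>. R (Suc k) \<omega> $ i $ j) = distr M borel (\<lambda>\<omega>. R (Suc 0) \<omega> $ i $ j)" for k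
        using R_ident[of "Suc k"] by simp
      show "integrable M (\<lambda>\<omega>. R (Suc 0) \<omega> $ i $ j)"
        using R_entry_integrable by simp
      fix l k :: nat assume lk: "l < k"
      let ?f = "\<lambda>h :: (real^'k) \<times> (nat \<Rightarrow> real^'k^'k) \<times> (nat \<Rightarrow> real^'k).
          (fst (snd h) (Suc l) $ i $ j, snd (snd h) (Suc l) $ i, snd (snd h) (Suc k) $ i)"
      have ind: "indep_rvs M (past_space k (Suc k)) (urn_history C R chi k (Suc k))
          (PiM {Suc k..} (\<lambda>_. borel)) (\<lambda>\<omega>. \<lambda>m\<in>{Suc k..}. R m \<omega>)"
        using future_indep[of "Suc k"] by simp
      have future: "(\<lambda>\<omega>. \<lambda>m\<in>{Suc k..}. R m \<omega>) \<in> measurable M (PiM {Suc k..} (\<lambda>_. borel))"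
        by (rule measurable_restrict) (simp add: measurable_R)
      have [measurable]: "(\<lambda>h. fst (snd h) (Suc l)) \<in> borel_measurable (past_space k (Suc k))"
        "(\<lambda>h. snd (snd h) (Suc l)) \<in> borel_measurable (past_space k (Suc k))"
        "(\<lambda>h. snd (snd h) (Suc k)) \<in> borel_measurable (past_space k (Suc k))"
        using lk by (auto intro!: measurable_history_R measurable_history_chi)
      have f: "?f \<in> borel_measurable (past_space k (Suc k))"
        unfolding borel_prod[symmetric] by measurable
      have [measurable]: "(\<lambda>r. r (Suc k)) \<in> borel_measurable (PiM {Suc k..} (\<lambda>_. borel :: (real^'k^'k) measure))"
        by (rule measurable_component_singleton) simp
      have g: "(\<lambda>r. r (Suc k) $ i $ j) \<in> borel_measurable (PiM {Suc k..} (\<lambda>_. borel :: (real^'k^'k) measure))"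
        by measurable
      from indep_rvs_compose[OF ind measurable_urn_history future f g]
      show "indep_rvs M borel (\<lambda>\<omega>. (R (Suc l) \<omega> $ i $ j, chi (Suc l) \<omega> $ i, chi (Suc k) \<omega> $ i))
          borel (\<lambda>\<omega>. R (Suc k) \<omega> $ i $ j)"
        using lk by (simp add: urn_history_def)
    qed measurable
    then show ?thesis by (simp add: H_entry)
  qed
  have "converges_as_and_L1 M (\<lambda>n \<omega>. \<Sum>i\<in>UNIV. (\<Sum>k<n. chi (Suc k) \<omega> $ i * (R (Suc k) \<omega> $ i $ j - H $ i $ j)) / real n)
      (\<Sum>i\<in>(UNIV :: 'k set). 0)"
    by (intro converges_as_and_L1_sum entry) simp
  moreover have "(\<Sum>i\<in>UNIV. (\<Sum>k<n. chi (Suc k) \<omega> $ i * (R (Suc k) \<omega> $ i $ j - H $ i $ j)) / real n)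
      = ((\<Sum>k<n. chi (Suc k) \<omega> v* (R (Suc k) \<omega> - H)) /\<^sub>R real n) $ j" for n \<omega>
    by (subst sum_divide_distrib[symmetric], subst sum.swap) (simp add: vec_mult_nth divide_inverse mult.commute)
  ultimately show "converges_as_and_L1 M (\<lambda>n \<omega>. ((\<Sum>k<n. chi (Suc k) \<omega> v* (R (Suc k) \<omega> - H)) /\<^sub>R real n) $ j) (0 $ j)"
    by simp
qed

text \<open>Compositions are functions of the recorded past, because \<open>C\<close> can be recomputed from it.\<close>

lemma composition_history_measurable:
  assumes "m \<le> k"
  obtains f where "f \<in> borel_measurable (past_space k k)"
    "\<And>\<omega>. \<omega> \<in> space M \<Longrightarrow> composition m \<omega> = f (urn_history C R chi k k \<omega>)"
proof -
  define c :: "(real^'k) \<times> (nat \<Rightarrow> real^'k^'k) \<times> (nat \<Rightarrow> real^'k) \<Rightarrow> real^'k"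
    where "c h = fst h + (\<Sum>l<m. snd (snd h) (Suc l) v* fst (snd h) (Suc l))" for h
  have "(\<lambda>h. snd (snd h) (Suc l) v* fst (snd h) (Suc l)) \<in>
      borel_measurable (past_space k k)"
    if "l < m" for l
    using that assms by (intro measurable_vec_mult measurable_history_R measurable_history_chi) auto
  moreover have "fst \<in> borel_measurable (past_space k k)"
    unfolding history_space_def by measurable
  ultimately have [measurable]: "c \<in> borel_measurable (past_space k k)"
    unfolding c_def[abs_def] by (intro borel_measurable_add borel_measurable_sum) auto
  have c: "C m \<omega> = c (urn_history C R chi k k \<omega>)" if "\<omega> \<in> space M" for \<omega>
    using assms by (subst C_eq_sum[OF that]) (auto simp: c_def urn_history_def intro!: sum.cong)
  show ?thesis
  proof
    show "(\<lambda>h. c h /\<^sub>R (\<Sum>i\<in>UNIV. c h $ i)) \<in> borel_measurable (past_space k k)"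
      by measurable
    show "composition m \<omega> = c (urn_history C R chi k k \<omega>) /\<^sub>R (\<Sum>i\<in>UNIV. c (urn_history C R chi k k \<omega>) $ i)"
      if "\<omega> \<in> space M" for \<omega>
      using c[OF that] by (simp add: composition_def total_content_def)
  qed
qed

text \<open>
  The composition is the conditional expectation of the next draw given the past, and
  earlier errors are functions of that past. Hence the errors are uncorrelated.
\<close>

lemma sampling_error_converges:
  "converges_as_and_L1 M (\<lambda>n \<omega>. (\<Sum>k<n. chi (Suc k) \<omega> - composition k \<omega>) /\<^sub>R real n) 0"
proof (rule converges_as_and_L1_vec)
  fix i
  define D where "D k \<omega> = chi (Suc k) \<omega> $ i - composition k \<omega> $ i" for k \<omega>
  have [measurable]: "D k \<in> borel_measurable M" for k
    unfolding D_def by measurable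
  have D_bound: "AE \<omega> in M. \<bar>D k \<omega>\<bar> \<le> 1" for k
    using chi_bounds composition_bounds
  proof eventually_elim
    case (elim \<omega>)
    then have "0 \<le> chi (Suc k) \<omega> $ i" "chi (Suc k) \<omega> $ i \<le> 1" "0 \<le> composition k \<omega> $ i" "composition k \<omega> $ i \<le> 1"
      by auto
    then show ?case unfolding D_def by linarith
  qed
  have "converges_as_and_L1 M (\<lambda>n \<omega>. (\<Sum>k<n. D k \<omega>) / real n) 0"
  proof (rule strong_law_bounded_uncorrelated[OF _ D_bound])
    fix j k :: nat assume jk: "j < k"
    let ?F = "vimage_algebra (space M) (urn_history C R chi k k) (past_space k k)"
    let ?I = "indicator {\<omega> \<in> space M. chi (Suc k) \<omega> = axis i 1} :: 'a \<Rightarrow> real"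
    have sub: "subalgebra M ?F"
      unfolding subalgebra_def using measurable_urn_history[of k k] by (auto intro: sets_image_in_sets[THEN subsetD])
    interpret F: finite_measure_subalgebra M ?F
      by unfold_locales (rule sub)
    have hist: "urn_history C R chi k k \<in> measurable ?F (past_space k k)"
      using measurable_urn_history[of k k] by (intro measurable_vimage_algebra1) (auto simp: measurable_def)
    obtain f where f: "f \<in> borel_measurable (past_space k k)"
      "\<And>\<omega>. \<omega> \<in> space M \<Longrightarrow> composition j \<omega> = f (urn_history C R chi k k \<omega>)"
      using composition_history_measurable[of j k] jk by auto
    have "(\<lambda>\<omega>. snd (snd (urn_history C R chi k k \<omega>)) (Suc j) $ i - f (urn_history C R chi k k \<omega>) $ i) \<in> borel_measurable ?F"
      using jk by (intro borel_measurable_diff measurable_vec_nth measurable_compose[OF hist]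
            measurable_history_chi f(1)) auto
    then have DF: "D j \<in> borel_measurable ?F"
      by (rule measurable_cong[THEN iffD1, rotated])
         (use jk f(2) in \<open>auto simp: D_def urn_history_def\<close>)
    have meas_I [measurable]: "?I \<in> borel_measurable M"
      by measurable
    have int: "integrable M (\<lambda>\<omega>. D j \<omega> * ?I \<omega>)"
      by (rule integrable_const_bound[of _ 1]) (use D_bound[of j] in \<open>auto elim!: eventually_mono simp: abs_mult indicator_def\<close>)
    have int_p: "integrable M (\<lambda>\<omega>. D j \<omega> * composition k \<omega> $ i)"
    proof (rule integrable_const_bound[of _ "1 * 1"])
      show "AE \<omega> in M. norm (D j \<omega> * composition k \<omega> $ i) \<le> 1 * 1"
        using D_bound[of j] composition_bounds
      proof eventually_elim
        case (elim \<omega>)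
        have "\<bar>D j \<omega>\<bar> * \<bar>composition k \<omega> $ i\<bar> \<le> 1 * 1"
          by (rule mult_mono) (use elim in auto)
        then show ?case by (simp add: abs_mult)
      qed
    qed measurable
    have chi_I: "AE \<omega> in M. chi (Suc k) \<omega> $ i = ?I \<omega>"
      using chi_unit[of "Suc k", simplified] AE_space
      by eventually_elim (auto simp: indicator_def axis_def vec_eq_iff)
    have "expectation (\<lambda>\<omega>. D j \<omega> * D k \<omega>) = expectation (\<lambda>\<omega>. D j \<omega> * ?I \<omega> - D j \<omega> * composition k \<omega> $ i)"
      by (rule integral_cong_AE) (use chi_I in \<open>auto elim!: eventually_mono simp: D_def[of k] algebra_simps\<close>)
    also have "\<dots> = expectation (\<lambda>\<omega>. D j \<omega> * ?I \<omega>) - expectation (\<lambda>\<omega>. D j \<omega> * composition k \<omega> $ i)"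
      by (rule Bochner_Integration.integral_diff[OF int int_p])
    also have "expectation (\<lambda>\<omega>. D j \<omega> * ?I \<omega>) = expectation (\<lambda>\<omega>. D j \<omega> * real_cond_exp M ?F ?I \<omega>)"
      by (rule F.real_cond_exp_intg(2)[OF int DF meas_I, symmetric])
    also have "\<dots> = expectation (\<lambda>\<omega>. D j \<omega> * composition k \<omega> $ i)"
      by (rule integral_cong_AE)
         (use draw[of "Suc k" i] in \<open>auto elim!: eventually_mono simp: composition_def divide_inverse mult.commute\<close>)
    finally show "expectation (\<lambda>\<omega>. D j \<omega> * D k \<omega>) = 0" by simp
  qed simp
  then show "converges_as_and_L1 M (\<lambda>n \<omega>. ((\<Sum>k<n. chi (Suc k) \<omega> - composition k \<omega>) /\<^sub>R real n) $ i) (0 $ i)"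
    by (simp add: D_def divide_inverse mult.commute)
qed

definition fluctuation :: "nat \<Rightarrow> 'a \<Rightarrow> real^'k" where
  "fluctuation n \<omega> = C n \<omega> - (\<Sum>k<n. composition k \<omega>) v* H"

lemma fluctuation_converges: "converges_as_and_L1 M (\<lambda>n \<omega>. fluctuation n \<omega> /\<^sub>R real n) 0"
proof -
  have init: "converges_as_and_L1 M (\<lambda>n \<omega>. C 0 \<omega> /\<^sub>R real n) 0"
  proof -
    have "(\<lambda>n. C 0 \<omega> /\<^sub>R real n) \<longlonglongrightarrow> 0" for \<omega>
      using tendsto_scaleR[OF lim_inverse_n tendsto_const, of "C 0 \<omega>"] by simp
    moreover have "(\<lambda>n. inverse (real n) * expectation (\<lambda>\<omega>. norm (C 0 \<omega>))) \<longlonglongrightarrow> 0"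
      by (intro tendsto_mult_left_zero lim_inverse_n)
    ultimately show ?thesis
      using C0_mean by (simp add: converges_as_and_L1_def)
  qed
  have zero: "(0 :: real^'k) + (0 + 0 v* H) = 0" by simp
  have sum_conv: "converges_as_and_L1 M (\<lambda>n \<omega>. C 0 \<omega> /\<^sub>R real n
      + ((\<Sum>k<n. chi (Suc k) \<omega> v* (R (Suc k) \<omega> - H)) /\<^sub>R real n
        + ((\<Sum>k<n. chi (Suc k) \<omega> - composition k \<omega>) /\<^sub>R real n) v* H)) (0 + (0 + 0 v* H))"
    by (intro converges_as_and_L1_add init replacement_error_converges
          converges_as_and_L1_linear[OF bounded_linear_vec_mult] sampling_error_converges)
  show ?thesis
  proof (rule converges_as_and_L1_cong[OF sum_conv[unfolded zero]])
    fix n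
    show "(\<lambda>\<omega>. fluctuation n \<omega> /\<^sub>R real n) \<in> borel_measurable M"
      unfolding fluctuation_def by measurable
    show "AE \<omega> in M. C 0 \<omega> /\<^sub>R real n
      + ((\<Sum>k<n. chi (Suc k) \<omega> v* (R (Suc k) \<omega> - H)) /\<^sub>R real n
        + ((\<Sum>k<n. chi (Suc k) \<omega> - composition k \<omega>) /\<^sub>R real n) v* H) = fluctuation n \<omega> /\<^sub>R real n"
      using AE_space
    proof eventually_elim
      case (elim \<omega>)
      interpret bounded_linear "\<lambda>x. x v* H" by (rule bounded_linear_vec_mult)
      show ?case
        unfolding fluctuation_def C_eq_sum[OF elim, of n]
        by (simp add: scaleR diff sum vector_matrix_mult_diff_rdistrib sum_subtractf algebra_simps)
    qed
  qed
qed

theorem convergence: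
  defines "l \<equiv> dominant_eigenvalue H" and "p \<equiv> dominant_left_eigenvector H"
  shows composition_converges: "converges_as_and_L1 M (\<lambda>n \<omega>. C n \<omega> /\<^sub>R S n \<omega>) p"
    and total_converges: "converges_as_and_L1 M (\<lambda>n \<omega>. S n \<omega> / real n) l"
    and content_converges: "converges_as_and_L1 M (\<lambda>n \<omega>. C n \<omega> /\<^sub>R real n) (l *\<^sub>R p)"
    and count_converges: "converges_as_and_L1 M (\<lambda>n \<omega>. count_vector chi n \<omega> /\<^sub>R real n) p"
proof -
  note pf = perron_frobenius[OF H_irreducible, folded l_def p_def]
  obtain u where u: "H *v u = l *\<^sub>R u" "\<And>i. 0 < u $ i"
    using pf(5) by blast
  have "AE \<omega> in M. (\<lambda>n. fluctuation n \<omega> /\<^sub>R real n) \<longlonglongrightarrow> 0"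
    using fluctuation_converges by (simp add: converges_as_and_L1_def)
  then have p_as: "AE \<omega> in M. (\<lambda>n. composition n \<omega>) \<longlonglongrightarrow> p"
    using content_pos_nonneg
  proof eventually_elim
    case (elim \<omega>)
    interpret driven_sequence H l p u "\<lambda>n. C n \<omega>" "\<lambda>n. fluctuation n \<omega>" "\<lambda>n. S n \<omega>"
      by unfold_locales
         (use elim pf u H_irreducible in \<open>auto simp: total_content_def fluctuation_def composition_def\<close>)
    show ?case unfolding composition_def by (rule composition_tendsto)
  qed
  have "converges_as_and_L1 M composition p"
    by (rule converges_as_and_L1_bounded[OF _ _ p_as, of 1])
       (use composition_bounds in \<open>auto elim!: eventually_mono\<close>)
  then show "converges_as_and_L1 M (\<lambda>n \<omega>. C n \<omega> /\<^sub>R S n \<omega>) p"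
    by (simp add: composition_def[abs_def])
  have mean: "converges_as_and_L1 M (\<lambda>n \<omega>. (\<Sum>k<n. composition k \<omega>) /\<^sub>R real n) p"
  proof (rule converges_as_and_L1_bounded[of _ 1])
    show "AE \<omega> in M. (\<lambda>n. (\<Sum>k<n. composition k \<omega>) /\<^sub>R real n) \<longlonglongrightarrow> p"
      using p_as by eventually_elim (rule cesaro_mean_tendsto)
    show "AE \<omega> in M. norm ((\<Sum>k<n. composition k \<omega>) /\<^sub>R real n) \<le> 1" for n
      using composition_bounds
    proof eventually_elim
      case (elim \<omega>)
      have "norm (\<Sum>k<n. composition k \<omega>) \<le> (\<Sum>k<n. 1)"
        using elim by (intro order_trans[OF norm_sum sum_mono]) auto
      then show ?case by (cases "n = 0") (auto simp: field_simps)
    qed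
  qed measurable
  have "converges_as_and_L1 M (\<lambda>n \<omega>. fluctuation n \<omega> /\<^sub>R real n
      + ((\<Sum>k<n. composition k \<omega>) /\<^sub>R real n) v* H) (0 + p v* H)"
    by (intro converges_as_and_L1_add fluctuation_converges
          converges_as_and_L1_linear[OF bounded_linear_vec_mult] mean)
  then show content: "converges_as_and_L1 M (\<lambda>n \<omega>. C n \<omega> /\<^sub>R real n) (l *\<^sub>R p)"
    by (simp add: fluctuation_def pf(2) scaleR_vector_matrix_assoc flip: scaleR_add_right)
  have "bounded_linear (\<lambda>x :: real^'k. \<Sum>i\<in>UNIV. x $ i)"
    by (intro bounded_linear_sum bounded_linear_vec_nth)
  from converges_as_and_L1_linear[OF this content]
  show "converges_as_and_L1 M (\<lambda>n \<omega>. S n \<omega> / real n) l"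
    by (simp add: total_content_def[abs_def] pf(4) divide_inverse mult.commute flip: sum_distrib_left)
  have "converges_as_and_L1 M (\<lambda>n \<omega>. (\<Sum>k<n. chi (Suc k) \<omega> - composition k \<omega>) /\<^sub>R real n
      + (\<Sum>k<n. composition k \<omega>) /\<^sub>R real n) (0 + p)"
    by (intro converges_as_and_L1_add sampling_error_converges mean)
  then show "converges_as_and_L1 M (\<lambda>n \<omega>. count_vector chi n \<omega> /\<^sub>R real n) p"
    by (simp add: count_vector_def[abs_def] sum.atLeast1_atMost_eq sum_subtractf flip: scaleR_add_right)
qed

end

theorem theorem2p3:
  fixes M :: "'a measure"
    and C :: "nat \<Rightarrow> 'a \<Rightarrow> real^'k"
    and R :: "nat \<Rightarrow> 'a \<Rightarrow> real^'k^'k"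
    and chi :: "nat \<Rightarrow> 'a \<Rightarrow> real^'k"
    and S :: "nat \<Rightarrow> 'a \<Rightarrow> real"
    and N :: "nat \<Rightarrow> 'a \<Rightarrow> real^'k"
    and H :: "real^'k^'k"
    and lambda_H :: real
    and pi_H :: "real^'k"
  assumes urn: "urn_model M C R chi"
    and S_def: "S = total_content C"
    and N_def: "N = count_vector chi"
    and C0_nonzero: "AE \<omega> in M. C 0 \<omega> \<noteq> 0"
    and C0_nonneg: "AE \<omega> in M. \<forall>i. 0 \<le> C 0 \<omega> $ i"
    and C0_mean: "integrable M (C 0)"
    and R_indep: "prob_space.indep_vars M (\<lambda>_. borel) R {1..}"
    and R_ident: "\<And>n. n \<ge> 1 \<Longrightarrow> distr M borel (R n) = distr M borel (R 1)"
    and R_indep_C0: "indep_rvs M borel (C 0) (PiM {1..} (\<lambda>_. borel)) (\<lambda>\<omega>. \<lambda>m\<in>{1..}. R m \<omega>)"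
    and H_def: "H = (\<integral>\<omega>. R 1 \<omega> \<partial>M)"
    and H_irreducible: "irreducible_matrix H"
    and R_mean: "integrable M (\<lambda>\<omega>. max_row_sum (R 1 \<omega>))"
    and draw: "\<And>n i. n \<ge> 1 \<Longrightarrow>
      AE \<omega> in M.
        real_cond_exp M
          (vimage_algebra (space M) (urn_history C R chi (n - 1) (n - 1)) (history_space (n - 1) (n - 1)))
          (indicator {\<omega> \<in> space M. chi n \<omega> = axis i 1}) \<omega>
        = C (n - 1) \<omega> $ i / S (n - 1) \<omega>"
    and future_indep: "\<And>n. n \<ge> 1 \<Longrightarrow>
      indep_rvs M
        (history_space (n - 1) n) (urn_history C R chi (n - 1) n)
        (PiM {n..} (\<lambda>_. borel)) (\<lambda>\<omega>. \<lambda>m\<in>{n..}. R m \<omega>)"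
    and lambda_H_def: "lambda_H = dominant_eigenvalue H"
    and pi_H_def: "pi_H = dominant_left_eigenvector H"
  shows "converges_as_and_L1 M (\<lambda>n \<omega>. C n \<omega> /\<^sub>R S n \<omega>) pi_H \<and>
         converges_as_and_L1 M (\<lambda>n \<omega>. S n \<omega> / real n) lambda_H \<and>
         converges_as_and_L1 M (\<lambda>n \<omega>. C n \<omega> /\<^sub>R real n) (lambda_H *\<^sub>R pi_H) \<and>
         converges_as_and_L1 M (\<lambda>n \<omega>. N n \<omega> /\<^sub>R real n) pi_H"
proof -
  interpret urn: urn_model M C R chi by (rule urn)
  interpret iid_urn M C R chi H
    by unfold_locales
       (fact C0_nonzero C0_nonneg C0_mean R_ident H_def H_irreducible R_mean draw[unfolded S_def] future_indep)+
  show ?thesis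
    unfolding S_def N_def lambda_H_def pi_H_def
    using composition_converges total_converges content_converges count_converges by blast
qed

end
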